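(* Let $d\ge 3$ be an integer, let $G$ be a $K_{1,3}$-free graph of maximum degree $d$, and let $M$ be an induced matching of $G$ produced by applying Local Search to $G$. Then $|M|\geq\dfrac{m(G)}{d^2+d-1}$.
   Context: Graphs are finite, simple, and undirected; $E(G)$ is the edge set of $G$ and $m(G)=|E(G)|$. $G$ is $K_{1,3}$-free (claw-free) if it contains no $K_{1,3}$ as an induced subgraph. A set $M\subseteq E(G)$ is an induced matching of $G$ if the subgraph of $G$ induced by the set of vertices incident with edges in $M$ is $1$-regular (the empty set is an induced matching). Local Search is the following algorithm on input $G$: start with $M=\emptyset$ and repeat the following iteration: (1) if $M\cup\{e\}$ is an induced matching of $G$ for some edge $e\in E(G)\setminus M$, replace $M$ by $M\cup\{e\}$; (2) if $(M\setminus\{e\})\cup\{e',e''\}$ is an induced matching of $G$ for some three distinct edges $e\in M$ and $e',e''\in E(G)\setminus M$, replace $M$ by $(M\setminus\{e\})\cup\{e',e''\}$. The choices are arbitrary. Stop when $|M|$ does not increase during one iteration (i.e. neither (1) nor (2) is possible), and return $M$. *)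

theory Defs
  imports Complex_Main
begin

record 'a graph =
  verts :: "'a set"
  edges :: "'a set set"

definition simple_graph :: "'a graph \<Rightarrow> bool" where
  "simple_graph G \<longleftrightarrow>
     finite (verts G) \<and> (\<forall>e\<in>edges G. e \<subseteq> verts G \<and> card e = 2)"

definition size_graph :: "'a graph \<Rightarrow> nat" where
  "size_graph G = card (edges G)"

definition degree :: "'a graph \<Rightarrow> 'a \<Rightarrow> nat" where
  "degree G v = card {e \<in> edges G. v \<in> e}"

(* The inserted 0 only matters for the graph without vertices. *)
definition max_degree :: "'a graph \<Rightarrow> nat" where
  "max_degree G = Max (insert 0 (degree G ` verts G))"

definition regular :: "nat \<Rightarrow> 'a graph \<Rightarrow> bool" where
  "regular k G \<longleftrightarrow> (\<forall>v\<in>verts G. degree G v = k)"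

definition induced_subgraph :: "'a graph \<Rightarrow> 'a set \<Rightarrow> 'a graph" where
  "induced_subgraph G S = \<lparr>verts = verts G \<inter> S, edges = {e \<in> edges G. e \<subseteq> S}\<rparr>"

definition isomorphic :: "'a graph \<Rightarrow> 'b graph \<Rightarrow> bool" where
  "isomorphic G H \<longleftrightarrow>
     (\<exists>f. bij_betw f (verts G) (verts H) \<and> (\<lambda>e. f ` e) ` edges G = edges H)"

definition contains_induced :: "'a graph \<Rightarrow> 'b graph \<Rightarrow> bool" where
  "contains_induced G H \<longleftrightarrow> (\<exists>S \<subseteq> verts G. isomorphic (induced_subgraph G S) H)"

definition claw :: "nat graph" where
  "claw = \<lparr>verts = {0, 1, 2, 3}, edges = {{0, 1}, {0, 2}, {0, 3}}\<rparr>"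

definition claw_free :: "'a graph \<Rightarrow> bool" where
  "claw_free G \<longleftrightarrow> \<not> contains_induced G claw"

definition induced_matching :: "'a graph \<Rightarrow> 'a set set \<Rightarrow> bool" where
  "induced_matching G M \<longleftrightarrow> M \<subseteq> edges G \<and> regular 1 (induced_subgraph G (\<Union>M))"

definition add_move :: "'a graph \<Rightarrow> 'a set set \<Rightarrow> 'a set set \<Rightarrow> bool" where
  "add_move G M M' \<longleftrightarrow>
     (\<exists>e \<in> edges G - M. M' = M \<union> {e} \<and> induced_matching G M')"

definition swap_move :: "'a graph \<Rightarrow> 'a set set \<Rightarrow> 'a set set \<Rightarrow> bool" where
  "swap_move G M M' \<longleftrightarrow>
     (\<exists>e \<in> M. \<exists>e' \<in> edges G - M. \<exists>e'' \<in> edges G - M. e' \<noteq> e'' \<and>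
        M' = (M - {e}) \<union> {e', e''} \<and> induced_matching G M')"

(* "If some move is possible, perform one (arbitrarily chosen); otherwise leave M unchanged." *)
definition perform_if_possible ::
  "('a set set \<Rightarrow> 'a set set \<Rightarrow> bool) \<Rightarrow> 'a set set \<Rightarrow> 'a set set \<Rightarrow> bool" where
  "perform_if_possible move M M' \<longleftrightarrow> move M M' \<or> (\<nexists>M''. move M M'') \<and> M' = M"

definition local_search_iteration :: "'a graph \<Rightarrow> 'a set set \<Rightarrow> 'a set set \<Rightarrow> bool" where
  "local_search_iteration G M M' \<longleftrightarrow>
     (\<exists>N. perform_if_possible (add_move G) M N \<and> perform_if_possible (swap_move G) N M')"

(* Sets M that can occur at the beginning of an iteration. *)
inductive local_search_reaches :: "'a graph \<Rightarrow> 'a set set \<Rightarrow> bool" for G where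
  start: "local_search_reaches G {}"
| iterate: "local_search_reaches G M \<Longrightarrow> local_search_iteration G M M' \<Longrightarrow>
    card M < card M' \<Longrightarrow> local_search_reaches G M'"

(* M is a possible result: the choices in the algorithm are arbitrary. *)
definition local_search_output :: "'a graph \<Rightarrow> 'a set set \<Rightarrow> bool" where
  "local_search_output G M \<longleftrightarrow>
     (\<exists>M\<^sub>0. local_search_reaches G M\<^sub>0 \<and> local_search_iteration G M\<^sub>0 M \<and> \<not> card M\<^sub>0 < card M)"

end

theory Submission
  imports Defs
begin

text \<open>
  Two edges conflict if they share a vertex or are joined by an edge, so an induced matching is
  a set of pairwise non-conflicting edges. The algorithm returns a matching \<open>M\<close> to which no edge can be
  added and in which no edge can be exchanged for two. For \<open>e\<close> in \<open>M\<close> let \<open>C\<^sub>e\<close> be the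
  edges that conflict with \<open>e\<close>, and \<open>P\<^sub>e\<close> those that conflict with no other edge
  of \<open>M\<close>. The first property says that every edge lies in some \<open>C\<^sub>e\<close>; an edge that lies
  in only one of them is counted again in \<open>P\<^sub>e\<close>, so \<open>2 * m \<le> (\<Sum>e\<in>M. |C\<^sub>e| + |P\<^sub>e|)\<close>.
  The second property says that the edges of \<open>P\<^sub>e\<close> conflict pairwise. It therefore suffices to show
  \<open>|C\<^sub>e| + |P| \<le> 2 * (d\<^sup>2 + d - 1)\<close> whenever \<open>P \<subseteq> C\<^sub>e\<close> is pairwise conflicting
  (\<open>conflict_count\<close>).

  Let \<open>e = {u, v}\<close>. Its neighbours split into the private neighbours \<open>A\<close> of \<open>u\<close>, the
  private neighbours \<open>B\<close> of \<open>v\<close> and the common neighbours \<open>C\<close>; let \<open>Z\<close> be the rest of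
  the graph. Since there is no claw, \<open>A\<close>, \<open>B\<close> and the neighbourhood in \<open>Z\<close> of each neighbour
  of \<open>e\<close> are cliques. Summing degrees bounds \<open>|C\<^sub>e|\<close>. With \<open>C\<close> empty
  this alone gives \<open>d\<^sup>2 + d - 1\<close>, but \<open>C\<^sub>e\<close> can be larger
  when there are common neighbours, and then \<open>P\<close> has to be smaller than \<open>C\<^sub>e\<close> by
  twice the excess.

  The loss is measured on the edges inside \<open>A\<close>, inside \<open>B\<close>, and from \<open>A\<close>, \<open>B\<close>, \<open>C\<close>
  to \<open>Z\<close>. Let the ends be the vertices of \<open>Z\<close> that lie on edges of \<open>P\<close>. If no
  edge of \<open>P\<close> joins \<open>C\<close> to \<open>Z\<close>, all edges from \<open>C\<close> to \<open>Z\<close> are lost, and moreover an edge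
  of \<open>P\<close> inside \<open>A\<close> and one inside \<open>B\<close> have to be joined by an edge, so
  either there are few such edges or there are many edges between \<open>A\<close> and
  \<open>B\<close> (\<open>inner_product_bound\<close>). If no edge of \<open>P\<close> joins \<open>A \<union> B\<close> to \<open>Z\<close>, what is lost there suffices.
  In the remaining case ends reached from different ones of the sets \<open>A\<close>, \<open>B\<close>, \<open>C\<close> are
  adjacent (\<open>ends_of_different_sides\<close>), so no three ends are independent
  (\<open>ends_no_independent_triple\<close>): the ends span so many edges that their degrees leave
  room for few edges of \<open>P\<close> (\<open>outer_ends_bound\<close>). Furthermore, every edge of \<open>P\<close> inside \<open>A\<close> or \<open>B\<close>
  contains a neighbour of each end \<open>z\<close> reached from \<open>C\<close>. If some such \<open>z\<close> is adjacent to all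
  other ends, it has few neighbours in \<open>A \<union> B\<close>, which leaves few edges of \<open>P\<close> inside \<open>A\<close> and \<open>B\<close>
  (\<open>universal_end\<close>). Otherwise two nonadjacent ends have disjoint neighbourhoods in \<open>A\<close> and in \<open>B\<close>,
  and the edges of \<open>P\<close> inside \<open>A\<close> or \<open>B\<close> form a bipartite graph (\<open>nonadjacent_ends\<close>).
\<close>

section \<open>Numerical inequalities\<close>

text \<open>
  The numbers of private neighbours of the two ends of an edge may be replaced by their
  largest possible value \<open>d - 1 - c\<close>, where \<open>c\<close> is the number of common neighbours.
\<close>

lemma numeric_monotone:
  fixes x M d :: real
  assumes "x \<le> M" "M \<le> d"
  shows "2*d*x - x*(x-1) \<le> 2*d*M - M*(M-1)"
proof -
  have "0 \<le> (M-x)*(2*d - M - x + 1)" using assms by (intro mult_nonneg_nonneg) auto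
  then show ?thesis by (simp add: algebra_simps)
qed

text \<open>
  Here \<open>a\<close>, \<open>b\<close>, \<open>c\<close> stand for the sizes of \<open>A\<close>, \<open>B\<close>, \<open>C\<close>. With so few private neighbours on one
  side the degree sums alone suffice, even if \<open>P\<close> contains all conflicting edges. The proof
  substitutes the largest possible \<open>a\<close>; the difference of the two sides is then, up to a nonnegative
  multiple of \<open>c\<close>, a quadratic in \<open>d - c\<close> with roots at most \<open>b + 1\<close>.
\<close>

lemma numeric_small:
  fixes a b c d :: real
  assumes "a + c + 1 \<le> d" "b + c + 1 \<le> d" "b = 0 \<or> b = 1 \<or> b = 2" "0 \<le> c"
  shows "2 + 2*d*(a+b+c) - a*(a-1) - b*(b-1) \<le> 2*d^2 + 2*d - 2"
proof -
  have 1: "2*d*a - a*(a-1) \<le> 2*d*(d-1-c) - (d-1-c)*(d-1-c-1)"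
    using assms by (intro numeric_monotone) auto
  define k where "k = d - c"
  have d: "d = k + c" by (simp add: k_def)
  have k: "k \<ge> b + 1" using assms(2) by (simp add: k_def)
  have 2: "b=2 \<Longrightarrow> 0 \<le> k*(k-3)" "b=1 \<Longrightarrow> 0 \<le> (k-2)*(k+1)" "b=0 \<Longrightarrow> 0 \<le> (k-1)*(k+2)"
    using k by auto
  show ?thesis
    using assms(3) 1 2 assms(4) unfolding d
    by (elim disjE) (simp_all add: algebra_simps power2_eq_square)
qed

text \<open>
  Here \<open>p\<close> and \<open>q\<close> count the edges of \<open>P\<close> inside \<open>A\<close> and inside \<open>B\<close>, and \<open>t\<close> the edges between \<open>A\<close> and
  \<open>B\<close>. The expression \<open>p + q - 2 * p * q / ((a-1) * (b-1))\<close> is bilinear, so its maximum over the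
  possible values is attained with one of \<open>p\<close>, \<open>q\<close> extreme. In the proof, a value of \<open>p\<close> that is at
  least half of \<open>(a-1) * (b-1)\<close> forces \<open>q \<le> 2 * t\<close>, and conversely; if both are smaller, so is their weighted sum.
\<close>

lemma numeric_inner_tradeoff:
  fixes a b p q t :: real
  assumes "1 < b" "b \<le> a" "2*p \<le> a*(a-1)" "0 \<le> p" "0 \<le> q" "2*q \<le> b*(b-1)" "p*q \<le> t*((a-1)*(b-1))" "0 \<le> t"
  shows "2*(p + q - 2*t) \<le> a*(a-1)"
proof -
  define M where "M = (a-1)*(b-1)"
  have M: "M > 0" using assms by (simp add: M_def)
  have Ma: "M \<le> a*(a-1)" using assms unfolding M_def by (subst mult.commute, intro mult_mono) auto
  have ba: "b*(b-1) \<le> a*(a-1)" using assms by (intro mult_mono) auto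
  consider "M \<le> 2*p" | "M \<le> 2*q" | "2*p < M" "2*q < M" by linarith
  then show ?thesis
  proof cases
    case 1
    have "M*q \<le> (2*t)*M" using mult_right_mono[OF 1 \<open>0 \<le> q\<close>] assms(7) by (simp add: M_def algebra_simps)
    then have "q \<le> 2*t" using M by (simp add: mult.commute)
    then show ?thesis using assms(3,8) by argo
  next
    case 2
    have "M*p \<le> (2*t)*M" using mult_right_mono[OF 2 \<open>0 \<le> p\<close>] assms(7) by (simp add: M_def algebra_simps)
    then have "p \<le> 2*t" using M by (simp add: mult.commute)
    then show ?thesis using assms(6,8) ba by argo
  next
    case 3
    have "0 \<le> (M - 2*p)*(M - 2*q)" using 3 by simp
    then have "2*(p+q)*M \<le> M*M + 4*(p*q)" by (simp add: algebra_simps)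
    also have "\<dots> \<le> (M + 4*t)*M" using assms(7) by (simp add: M_def algebra_simps)
    finally have "2*(p+q) \<le> M + 4*t" using M by simp
    then show ?thesis using Ma by argo
  qed
qed

text \<open>
  The case in which \<open>P\<close> has no edge from \<open>C\<close> to \<open>Z\<close>. With the largest possible \<open>a\<close> the left-hand side
  is a concave quadratic in \<open>b\<close> and \<open>c\<close> without mixed term; the two squares in the proof
  are centred at its maximum.
\<close>

lemma numeric_no_common:
  fixes a b c d :: real
  assumes "a + c + 1 \<le> d" "0 \<le> c" "4 \<le> d"
  shows "2 + 2*d*(a+b) + d*c + 2*c - a*(a-1) - 3/2*(b*(b-1)) \<le> 2*d^2 + 2*d - 2"
proof -
  have 1: "2*d*a - a*(a-1) \<le> 2*d*(d-1-c) - (d-1-c)*(d-1-c-1)"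
    using assms by (intro numeric_monotone) auto
  have 2: "0 \<le> 3/2*(b - (2*d+3/2)/3)^2" "0 \<le> (c - (d-1)/2)^2" by auto
  have 3: "16 \<le> d^2" using power_mono[OF assms(3), of 2] by simp
  show ?thesis using 1 2 3 assms(3) by (simp add: field_simps power2_eq_square)
qed

text \<open>
  The case of an end reached from \<open>C\<close> that is adjacent to all \<open>m - 1\<close> other ends and has \<open>al\<close>
  neighbours in \<open>A\<close> and \<open>be\<close> in \<open>B\<close>.
\<close>

lemma numeric_universal:
  fixes a b c d al be m :: real
  assumes "a + c + 1 \<le> d" "b + c + 1 \<le> d" "3 \<le> a" "3 \<le> b" "1 \<le> c"
     "0 \<le> al" "0 \<le> be" "al + be + m \<le> d" "1 \<le> m"
  shows "2 + (d+1)*(a+b) + (d+2)*c + (m*(d+1) - m^2/2)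
     - (a-al)*(a-al-1)/2 - (b-be)*(b-be-1)/2 \<le> 2*d^2+2*d-2"
proof -
  define k where "k = d - c - 1"
  have d: "d = k + c + 1" by (simp add: k_def)
  have k: "a \<le> k" "b \<le> k" "3 \<le> k" using assms by (auto simp: k_def)
  have mono: "(d+1)*x - (x-y)*(x-y-1)/2 \<le> (d+1)*k - (k-y)*(k-y-1)/2"
    if "x \<le> k" "0 \<le> y" for x y
  proof -
    have "0 \<le> (k-x)*((d+1) - (k+x-2*y-1)/2)"
      using that assms unfolding d by (intro mult_nonneg_nonneg) (auto simp: field_simps)
    then show ?thesis by (simp add: field_simps)
  qed
  \<comment> \<open>By convexity of \<open>x * (x - 1)\<close> only the number \<open>n\<close> of non-neighbours of the end in both
    cliques, taken together at their largest size \<open>k\<close>, matters.\<close>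
  define n where "n = 2*k - al - be"
  have n: "m \<le> n + c + 1 - k" using assms(8) by (simp add: n_def d)
  have sq: "n^2/2 - n \<le> (k-al)*(k-al-1) + (k-be)*(k-be-1)"
    using zero_le_power2[of "al - be"]
    by (simp add: n_def field_simps power2_eq_square)
  have goal: "m*(k+c+2) - m^2/2 \<le> k*c + c^2 + 3*c + 2*k + (n^2/4 - n/2)"
  proof (cases "k - c - 1 + m \<ge> 1")
    case True
    have "0 \<le> (n - (k-c-1+m)) * (n + (k-c-1+m) - 2)"
      using True n by (intro mult_nonneg_nonneg) auto
    \<comment> \<open>With \<open>n\<close> replaced by its lower bound, the difference of the two sides is
      a convex quadratic in \<open>m\<close>, and this is its minimum point.\<close>
    moreover have "0 \<le> 3/4*(m - (k+3*c+6)/3)^2" by simp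
    moreover have "9 \<le> k^2" "1 \<le> c^2"
      using power_mono[OF k(3), of 2] power_mono[OF assms(5), of 2] by auto
    ultimately show ?thesis using assms(5) by (simp add: field_simps power2_eq_square)
  next
    case False
    have "0 \<le> (c - 1 - m)*(k+c+2)" using False k assms(5)
      by (intro mult_nonneg_nonneg) auto
    moreover have "0 \<le> (n - 1)^2" "0 \<le> m^2" by simp_all
    ultimately show ?thesis using assms(5) k(3) unfolding power2_eq_square by argo
  qed
  show ?thesis
    using mono[OF k(1) assms(6)] mono[OF k(2) assms(7)] sq goal
    unfolding d by (simp add: field_simps power2_eq_square)
qed

text \<open>
  The case of two nonadjacent ends reached from \<open>C\<close>; \<open>al\<close>, \<open>al'\<close> count their neighbours in \<open>A\<close>
  and \<open>be\<close>, \<open>be'\<close> those in \<open>B\<close>. These neighbours enter twice: the products bound the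
  edges of \<open>P\<close> inside \<open>A\<close> and \<open>B\<close>, and the sum is degree of the two ends not available for \<open>P\<close>.
\<close>

lemma numeric_nonadjacent:
  fixes a b c d al be al' be' m :: real
  assumes "a + c + 1 \<le> d" "b + c + 1 \<le> d" "3 \<le> a" "3 \<le> b" "2 \<le> c"
     "0 \<le> al" "0 \<le> al'" "al + al' \<le> a" "0 \<le> be" "0 \<le> be'" "be + be' \<le> b"
  shows "2 + (d+1)*(a+b) + (d+2)*c + (m*(d+1) - m^2/2 - (al+al'+be+be'))
     - a*(a-1)/2 - b*(b-1)/2 + al*al' + be*be' \<le> 2*d^2+2*d-2"
proof -
  define k where "k = d - c - 1"
  have d: "d = k + c + 1" by (simp add: k_def)
  have k: "a \<le> k" "b \<le> k" "3 \<le> k" using assms by (auto simp: k_def)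
  have mono: "(d+1)*x - x^2/4 - x/2 \<le> (d+1)*k - k^2/4 - k/2"
    if "x \<le> k" for x
  proof -
    have "0 \<le> (k-x)*((d+1) - (k+x)/4 - 1/2)"
      using that assms k unfolding d by (intro mult_nonneg_nonneg) (auto simp: field_simps)
    then show ?thesis by (simp add: field_simps power2_eq_square)
  qed
  have pr: "y*y' - (y+y') \<le> x^2/4 - x + 3/4" if "3 \<le> x" "0 \<le> y" "0 \<le> y'" "y+y' \<le> x" for x y y' :: real
  proof -
    define h where "h = y + y'"
    have h: "0 \<le> h" "h \<le> x" using that by (auto simp: h_def)
    have "4*(y*y') \<le> h^2" using zero_le_power2[of "y-y'"]
      by (simp add: h_def power2_eq_square algebra_simps)
    moreover have "h^2 - 4*h \<le> h*(x-4)"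
      using mult_left_mono[OF h(2) h(1)] by (simp add: power2_eq_square algebra_simps)
    moreover have "h*(x-4) \<le> x^2 - 4*x + 3"
    proof (cases "x \<ge> 4")
      case True
      then show ?thesis using mult_right_mono[OF h(2), of "x-4"]
        by (simp add: power2_eq_square algebra_simps)
    next
      case False
      then have "h*(x-4) \<le> 0" using h by (simp add: mult_nonneg_nonpos)
      moreover have "0 \<le> (x-1)*(x-3)" using that by simp
      ultimately show ?thesis by (simp add: power2_eq_square algebra_simps)
    qed
    ultimately show ?thesis by (simp add: h_def)
  qed
  have m: "m*(d+1) - m^2/2 \<le> (d+1)^2/2"
    using zero_le_power2[of "m - (d+1)"] unfolding power2_eq_square by argo
  have "4 \<le> c*c" using mult_mono[OF assms(5) assms(5)] assms(5) by simp
  then have fin: "2 + 2*((d+1)*k - k^2/4 - k/2) + 3/2 + (d+2)*c + (d+1)^2/2 \<le> 2*d^2+2*d-2"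
    using k(3) assms(5) by (simp add: d field_simps power2_eq_square)
  have half: "x*(x-1)/2 = x^2/4 - x + (x^2/4 + x/2)" for x :: real
    by (simp add: field_simps power2_eq_square)
  have sm: "(d+1)*(a+b) = (d+1)*a + (d+1)*b" by (simp add: algebra_simps)
  show ?thesis
    using mono[OF k(1)] mono[OF k(2)] pr[OF assms(3,6,7,8)] pr[OF assms(4,9,10,11)] m fin
    unfolding half sm by argo
qed

section \<open>Local optima and their conflicts\<close>

definition conflict :: "'a graph \<Rightarrow> 'a set \<Rightarrow> 'a set \<Rightarrow> bool" where
  "conflict G f g \<longleftrightarrow> (\<exists>x\<in>f. \<exists>y\<in>g. x = y \<or> {x, y} \<in> edges G)"

lemma conflict_sym: "conflict G f g \<longleftrightarrow> conflict G g f"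
  unfolding conflict_def by (metis insert_commute)

lemma conflict_refl: "f \<noteq> {} \<Longrightarrow> conflict G f f"
  unfolding conflict_def by auto

lemma simple_graph_finite_edges:
  assumes "simple_graph G"
  shows "finite (edges G)"
proof (rule finite_subset)
  show "edges G \<subseteq> Pow (verts G)" using assms by (auto simp: simple_graph_def)
  show "finite (Pow (verts G))" using assms by (simp add: simple_graph_def)
qed

text \<open>
  Regularity of degree one says that the only edge among the covered vertices at a vertex is its
  matching edge, which is the absence of conflicts.
\<close>

lemma induced_matching_iff:
  assumes "simple_graph G"
  shows "induced_matching G M \<longleftrightarrow>
    M \<subseteq> edges G \<and> (\<forall>f\<in>M. \<forall>g\<in>M. f \<noteq> g \<longrightarrow> \<not> conflict G f g)"
proof -
  have E: "finite (edges G)" "\<And>e. e \<in> edges G \<Longrightarrow> e \<subseteq> verts G" "\<And>e. e \<in> edges G \<Longrightarrow> card e = 2"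
    using assms simple_graph_finite_edges by (auto simp: simple_graph_def)
  let ?D = "\<lambda>v. {e \<in> edges G. e \<subseteq> \<Union>M \<and> v \<in> e}"
  have deg: "degree (induced_subgraph G (\<Union>M)) v = card (?D v)" for v
    by (simp add: degree_def induced_subgraph_def)
  have two: "e = {x, y}" if "e \<in> edges G" "x \<in> e" "y \<in> e" "x \<noteq> y" for e x y
    using E(3)[OF that(1)] that(2-4) by (auto simp: card_2_iff)
  show ?thesis
  proof (intro iffI conjI ballI impI notI; (elim conjE)?)
    assume "induced_matching G M"
    then show "M \<subseteq> edges G" by (simp add: induced_matching_def)
  next
    fix f g assume im: "induced_matching G M" and fg: "f \<in> M" "g \<in> M" "f \<noteq> g" "conflict G f g"
    have M: "M \<subseteq> edges G" and reg: "\<And>v. v \<in> verts G \<Longrightarrow> v \<in> \<Union>M \<Longrightarrow> card (?D v) = 1"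
      using im by (auto simp: induced_matching_def regular_def induced_subgraph_def degree_def)
    have uniq: "e = e'" if "e \<in> ?D v" "e' \<in> ?D v" for e e' v
    proof -
      have "v \<in> verts G" "v \<in> \<Union>M" using that E by auto
      then have "card (?D v) = 1" by (rule reg)
      then show ?thesis using that by (metis card_1_singletonE singletonD)
    qed
    obtain x y where xy: "x \<in> f" "y \<in> g" "x = y \<or> {x, y} \<in> edges G"
      using fg(4) by (auto simp: conflict_def)
    have in1: "f \<in> ?D x" "g \<in> ?D y" using fg xy M by auto
    from xy(3) show False
    proof
      assume "x = y" then show False using uniq[OF in1(1)] in1(2) fg(3) by simp
    next
      assume e: "{x, y} \<in> edges G"
      have "{x, y} \<in> ?D x" "{x, y} \<in> ?D y" using e fg xy by auto
      then have "f = {x, y}" "g = {x, y}" using uniq[OF in1(1)] uniq[OF in1(2)] by simp_all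
      then show False using fg(3) by simp
    qed
  next
    assume M: "M \<subseteq> edges G" and nc: "\<forall>f\<in>M. \<forall>g\<in>M. f \<noteq> g \<longrightarrow> \<not> conflict G f g"
    have "card (?D v) = 1" if v: "v \<in> \<Union>M" for v
    proof -
      obtain f where f: "f \<in> M" "v \<in> f" using v by auto
      have "e = f" if e: "e \<in> ?D v" for e
      proof -
        obtain y where y: "e = {v, y}" "v \<noteq> y"
          using e E(3)[of e] by (auto simp: card_2_iff doubleton_eq_iff)
        then obtain g where g: "g \<in> M" "y \<in> g" using e by auto
        have "conflict G f g" unfolding conflict_def using f g e y by auto
        then have "y \<in> f" using nc f g by auto
        then show ?thesis using two[of f v y] f y M by auto
      qed
      moreover have "f \<in> ?D v" using f M by auto
      ultimately have "?D v = {f}" by blast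
      then show ?thesis by simp
    qed
    then show "induced_matching G M"
      using M deg by (auto simp: induced_matching_def regular_def induced_subgraph_def degree_def)
  qed
qed

lemma local_search_reaches_induced_matching:
  assumes "local_search_reaches G M"
  shows "induced_matching G M"
  using assms
proof induction
  case start
  then show ?case by (auto simp: induced_matching_def regular_def induced_subgraph_def)
next
  case (iterate M M')
  then show ?case
    unfolding local_search_iteration_def perform_if_possible_def add_move_def swap_move_def
    by metis
qed

text \<open>
  Both moves enlarge the matching by one edge, so an iteration that does not enlarge it found
  neither move possible.
\<close>

lemma local_search_output_locally_optimal:
  assumes "simple_graph G" "local_search_output G M"
  shows "induced_matching G M" "\<nexists>M'. add_move G M M'" "\<nexists>M'. swap_move G M M'"
proof -
  obtain M0 where M0: "local_search_reaches G M0" "local_search_iteration G M0 M" "\<not> card M0 < card M"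
    using assms(2) by (auto simp: local_search_output_def)
  have im: "induced_matching G M0" by (rule local_search_reaches_induced_matching[OF M0(1)])
  obtain N where N: "perform_if_possible (add_move G) M0 N" "perform_if_possible (swap_move G) N M"
    using M0(2) by (auto simp: local_search_iteration_def)
  have fin: "finite N'" if "induced_matching G N'" for N'
    using that simple_graph_finite_edges[OF assms(1)]
    by (auto simp: induced_matching_def intro: finite_subset)
  have add: "card M1 < card M2" if "add_move G M1 M2" "finite M1" for M1 M2
    using that by (auto simp: add_move_def)
  have swap: "card M1 < card M2" if sw: "swap_move G M1 M2" and f: "finite M1" for M1 M2
  proof -
    obtain e e' e'' where e: "e \<in> M1" "e' \<notin> M1" "e'' \<notin> M1" "e' \<noteq> e''" "M2 = (M1 - {e}) \<union> {e', e''}"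
      using sw by (auto simp: swap_move_def)
    then have "card M2 = Suc (Suc (card (M1 - {e})))" using f by simp
    then show ?thesis using e(1) f by (simp add: card_Diff_singleton)
  qed
  have finN: "finite N" using N(1) im fin by (auto simp: perform_if_possible_def add_move_def)
  have le: "card N \<le> card M" using N(2) swap[OF _ finN] by (auto simp: perform_if_possible_def less_imp_le)
  have "\<not> add_move G M0 N" using add[of M0 N] fin[OF im] le M0(3) by auto
  then have NM: "N = M0" "\<nexists>M'. add_move G M0 M'" using N(1) by (auto simp: perform_if_possible_def)
  have "\<not> swap_move G N M" using swap[of N M] finN NM M0(3) by auto
  then have "M = M0" "\<nexists>M'. swap_move G M0 M'" using N(2) NM by (auto simp: perform_if_possible_def)
  then show "induced_matching G M" "\<nexists>M'. add_move G M M'" "\<nexists>M'. swap_move G M M'"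
    using im NM by auto
qed

text \<open>
  Double counting of pairs \<open>(e, f)\<close> with \<open>e \<in> M\<close> in conflict with \<open>f\<close>. An edge \<open>f\<close> in conflict with a single
  \<open>e\<close> contributes a second time through the private set \<open>P e\<close>. Two non-conflicting
  members of \<open>P e\<close> could replace \<open>e\<close>.
\<close>

lemma locally_optimal_bound:
  fixes K :: nat
  assumes simple: "simple_graph G"
    and M: "induced_matching G M" "\<nexists>M'. add_move G M M'" "\<nexists>M'. swap_move G M M'"
    and bound: "\<And>e P. e \<in> edges G \<Longrightarrow> P \<subseteq> {f \<in> edges G. conflict G e f} \<Longrightarrow>
        (\<forall>f\<in>P. \<forall>g\<in>P. conflict G f g) \<Longrightarrow>
        card {f \<in> edges G. conflict G e f} + card P \<le> 2 * K"
  shows "card (edges G) \<le> K * card M"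
proof -
  let ?E = "edges G"
  define C where "C e = {f \<in> ?E. conflict G e f}" for e
  define Mf where "Mf f = {e \<in> M. conflict G e f}" for f
  define P where "P e = {f \<in> ?E. Mf f = {e}}" for e
  have finE: "finite ?E" by (rule simple_graph_finite_edges[OF simple])
  have ME: "M \<subseteq> ?E" and Mc: "\<And>f g. f \<in> M \<Longrightarrow> g \<in> M \<Longrightarrow> f \<noteq> g \<Longrightarrow> \<not> conflict G f g"
    using M(1) induced_matching_iff[OF simple] by auto
  have finM: "finite M" using ME finE by (rule finite_subset)
  have ne: "e \<noteq> {}" if "e \<in> ?E" for e using that simple by (auto simp: simple_graph_def)
  have selfc: "conflict G e e" if "e \<in> ?E" for e by (rule conflict_refl[OF ne[OF that]])
  have Mf_ne: "Mf f \<noteq> {}" if f: "f \<in> ?E" for f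
  proof (cases "f \<in> M")
    case True
    then show ?thesis using selfc f by (auto simp: Mf_def)
  next
    case False
    then have "\<not> induced_matching G (M \<union> {f})" using M(2) f by (auto simp: add_move_def)
    then obtain g h where gh: "g \<in> M \<union> {f}" "h \<in> M \<union> {f}" "g \<noteq> h" "conflict G g h"
      unfolding induced_matching_iff[OF simple] using ME f by auto
    then have "\<exists>e\<in>M. conflict G e f" using Mc[of g h] conflict_sym[of G g h] by auto
    then show ?thesis by (auto simp: Mf_def)
  qed
  have Psub: "P e \<subseteq> C e" for e by (auto simp: P_def C_def Mf_def)
  have Pconf: "conflict G f g" if e: "e \<in> M" and f: "f \<in> P e" and g: "g \<in> P e" for e f g
  proof (rule ccontr)
    assume nc: "\<not> conflict G f g"
    have fg: "f \<in> ?E" "g \<in> ?E" "Mf f = {e}" "Mf g = {e}" using f g by (auto simp: P_def)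
    have fe: "conflict G e f" "conflict G e g" using fg(3,4) by (auto simp: Mf_def)
    have nc2: "\<not> conflict G g f" using nc conflict_sym[of G f g] by simp
    have "f \<noteq> e" "g \<noteq> e" using fe nc nc2 by auto
    then have nM: "f \<notin> M" "g \<notin> M" using fg selfc by (auto simp: Mf_def)
    have "f \<noteq> g" using nc selfc fg by auto
    have nc': "\<not> conflict G h f" "\<not> conflict G h g" "\<not> conflict G f h" "\<not> conflict G g h"
      if "h \<in> M" "h \<noteq> e" for h
      using that fg(3,4) conflict_sym[of G h f] conflict_sym[of G h g] by (auto simp: Mf_def)
    have "induced_matching G ((M - {e}) \<union> {f, g})"
      unfolding induced_matching_iff[OF simple]
      using ME fg(1,2) Mc nc nc2 nc' by auto
    then have "swap_move G M ((M - {e}) \<union> {f, g})"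
      unfolding swap_move_def using e fg(1,2) nM \<open>f \<noteq> g\<close> by blast
    then show False using M(3) by blast
  qed
  have local_bound: "card (C e) + card (P e) \<le> 2 * K" if e: "e \<in> M" for e
    unfolding C_def using bound[of e "P e"] Psub[of e] Pconf[OF e] ME e by (auto simp: C_def)
  have card_filter: "card {x \<in> X. Q x} = (\<Sum>x\<in>X. if Q x then 1 else 0)" if "finite X" for X :: "'a set set" and Q
    using that by (simp add: sum.If_cases Int_def)
  have "2 * card ?E = (\<Sum>f\<in>?E. 2)" by simp
  also have "\<dots> \<le> (\<Sum>f\<in>?E. card (Mf f) + (if card (Mf f) = 1 then 1 else 0))"
  proof (rule sum_mono)
    fix f assume "f \<in> ?E"
    then have "card (Mf f) \<noteq> 0" using Mf_ne[of f] finM by (auto simp: Mf_def)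
    then show "2 \<le> card (Mf f) + (if card (Mf f) = 1 then 1 else 0)" by auto
  qed
  also have "\<dots> = (\<Sum>f\<in>?E. \<Sum>e\<in>M. (if conflict G e f then 1 else 0) + (if Mf f = {e} then 1 else 0))"
  proof (rule sum.cong[OF refl])
    fix f assume "f \<in> ?E"
    have 1: "card (Mf f) = (\<Sum>e\<in>M. if conflict G e f then 1 else 0)"
      unfolding Mf_def by (rule card_filter[OF finM])
    have 2: "(if card (Mf f) = 1 then 1 else 0) = (\<Sum>e\<in>M. if Mf f = {e} then 1 else (0::nat))"
    proof (cases "card (Mf f) = 1")
      case True
      then obtain e where e: "Mf f = {e}" by (auto simp: card_1_singleton_iff)
      then have "e \<in> M" by (auto simp: Mf_def)
      then show ?thesis using e finM by simp
    next
      case False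
      then have "\<And>e. Mf f \<noteq> {e}" by auto
      then show ?thesis using False by simp
    qed
    show "card (Mf f) + (if card (Mf f) = 1 then 1 else 0) =
      (\<Sum>e\<in>M. (if conflict G e f then 1 else 0) + (if Mf f = {e} then 1 else 0))"
      unfolding sum.distrib using 1 2 by presburger
  qed
  also have "\<dots> = (\<Sum>e\<in>M. \<Sum>f\<in>?E. (if conflict G e f then 1 else 0) + (if Mf f = {e} then 1 else 0))"
    by (rule sum.swap)
  also have "\<dots> = (\<Sum>e\<in>M. card (C e) + card (P e))"
    by (simp add: sum.distrib C_def P_def card_filter[OF finE])
  also have "\<dots> \<le> (\<Sum>e\<in>M. 2 * K)" by (rule sum_mono) (rule local_bound)
  also have "\<dots> = 2 * (K * card M)" by simp
  finally show ?thesis by simp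
qed

section \<open>Counting edges between vertex sets\<close>

lemma card_Un_bound: "card X \<le> m \<Longrightarrow> card Y \<le> n \<Longrightarrow> card (X \<union> Y) \<le> m + n"
  using card_Un_le[of X Y] by linarith

lemma real_choose_two: "real (n choose 2) = real n * (real n - 1) / 2"
  by (induction n) (simp_all add: numeral_2_eq_2 field_simps)

text \<open>
  A form of Mantel's theorem for the complement. Two nonadjacent vertices have degree sum at least
  \<open>card K - 2\<close>, because every other vertex is adjacent to one of them; the bound follows by
  removing nonadjacent pairs until a clique remains.
\<close>

lemma no_independent_triple_dense:
  assumes "finite K"
    and sym: "\<And>x y. R x y \<Longrightarrow> R y x" and irrefl: "\<And>x. \<not> R x x"
    and triple: "\<And>x y z. x \<in> K \<Longrightarrow> y \<in> K \<Longrightarrow> z \<in> K \<Longrightarrow> x \<noteq> y \<Longrightarrow> x \<noteq> z \<Longrightarrow> y \<noteq> z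
      \<Longrightarrow> R x y \<or> R x z \<or> R y z"
  shows "(card K)\<^sup>2 \<le> 2 * (\<Sum>x\<in>K. card {y \<in> K. R x y}) + 2 * card K"
  using assms(1) triple
proof (induction "card K" arbitrary: K rule: less_induct)
  case less
  let ?D = "\<lambda>K. \<Sum>x\<in>K. card {y \<in> K. R x y}"
  show ?case
  proof (cases "\<exists>x\<in>K. \<exists>y\<in>K. x \<noteq> y \<and> \<not> R x y")
    case False
    have "{y \<in> K. R x y} = K - {x}" if "x \<in> K" for x
      using False that irrefl by auto
    then have "?D K = card K * (card K - 1)"
      using less.prems(1) by simp
    then show ?thesis by (cases "card K") (auto simp: power2_eq_square)
  next
    case True
    then obtain x y where xy: "x \<in> K" "y \<in> K" "x \<noteq> y" "\<not> R x y" by blast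
    define L where "L = K - {x, y}"
    have fin: "finite K" "finite L" using less.prems(1) by (auto simp: L_def)
    have K: "K = insert x (insert y L)" "x \<notin> insert y L" "y \<notin> L" using xy by (auto simp: L_def)
    have cK: "card K = card L + 2" using K fin by simp
    have IH: "(card L)\<^sup>2 \<le> 2 * ?D L + 2 * card L"
    proof (rule less.hyps)
      show "card L < card K" "finite L" using cK fin by auto
    next
      fix p q r assume "p \<in> L" "q \<in> L" "r \<in> L" "p \<noteq> q" "p \<noteq> r" "q \<noteq> r"
      then show "R p q \<or> R p r \<or> R q r" using less.prems(2)[of p q r] by (auto simp: L_def)
    qed
    let ?N = "\<lambda>z. {w \<in> L. R z w}"
    have split: "card {w \<in> K. R z w} = card (?N z) + card {w \<in> {x, y}. R z w}" for z
    proof -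
      have "{w \<in> K. R z w} = ?N z \<union> {w \<in> {x, y}. R z w}" using K(1) by auto
      moreover have "card (?N z \<union> {w \<in> {x, y}. R z w}) = card (?N z) + card {w \<in> {x, y}. R z w}"
        using fin K by (intro card_Un_disjoint) auto
      ultimately show ?thesis by simp
    qed
    have cover: "card L \<le> card (?N x) + card (?N y)"
    proof -
      have "L \<subseteq> ?N x \<union> ?N y"
        using less.prems(2) xy sym unfolding L_def by blast
      then have "card L \<le> card (?N x \<union> ?N y)" using fin by (intro card_mono) auto
      then show ?thesis using card_Un_le[of "?N x" "?N y"] by linarith
    qed
    have "(\<Sum>z\<in>L. card {w \<in> {x, y}. R z w}) = card (?N x) + card (?N y)"
    proof -
      have "card {w \<in> {x, y}. R z w} = (if R x z then 1 else 0) + (if R y z then 1 else 0)" for z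
      proof -
        have "{w \<in> {x, y}. R z w} = (if R x z then {x} else {}) \<union> (if R y z then {y} else {})"
          using sym by auto
        then show ?thesis using xy(3) by simp
      qed
      then show ?thesis using fin by (simp add: sum.distrib sum.If_cases Int_def)
    qed
    then have "(\<Sum>z\<in>L. card {w \<in> K. R z w}) = ?D L + (card (?N x) + card (?N y))"
      by (simp only: split sum.distrib)
    moreover have "sum g K = g x + (g y + sum g L)" for g :: "'a \<Rightarrow> nat"
      using K fin by simp
    ultimately have "?D K = card {w \<in> K. R x w} + (card {w \<in> K. R y w} + (?D L + (card (?N x) + card (?N y))))"
      by simp
    then have "?D K \<ge> ?D L + 2 * card L" using cover split[of x] split[of y] by linarith
    then show ?thesis using IH cK by (simp add: power2_eq_square)
  qed
qed

text \<open>
  Ordered pairs are counted so that degree sums decompose additively over disjoint target sets;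
  for \<open>X = Y\<close> every edge is counted twice.
\<close>

definition cross :: "'a set set \<Rightarrow> 'a set \<Rightarrow> 'a set \<Rightarrow> nat" where
  "cross F X Y = card {(x, y). x \<in> X \<and> y \<in> Y \<and> {x, y} \<in> F}"

lemma finite_cross: "finite X \<Longrightarrow> finite Y \<Longrightarrow> finite {(x, y). x \<in> X \<and> y \<in> Y \<and> {x, y} \<in> F}"
  by (rule finite_subset[of _ "X \<times> Y"]) auto

lemma cross_commute: "cross F X Y = cross F Y X"
  unfolding cross_def
  by (rule bij_betw_same_card[of prod.swap])
    (auto simp: bij_betw_def inj_on_def insert_commute image_iff)

lemma cross_Un:
  assumes "finite X" "finite Y" "finite Y'" "Y \<inter> Y' = {}"
  shows "cross F X (Y \<union> Y') = cross F X Y + cross F X Y'"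
proof -
  have "{(x, y). x \<in> X \<and> y \<in> Y \<union> Y' \<and> {x, y} \<in> F} =
    {(x, y). x \<in> X \<and> y \<in> Y \<and> {x, y} \<in> F} \<union> {(x, y). x \<in> X \<and> y \<in> Y' \<and> {x, y} \<in> F}" by auto
  then show ?thesis unfolding cross_def
    using assms by (simp add: card_Un_disjoint finite_cross disjoint_iff)
qed

lemma cross_sum:
  assumes "finite X" "finite Y"
  shows "cross F X Y = (\<Sum>x\<in>X. card {y \<in> Y. {x, y} \<in> F})"
proof -
  have "{(x, y). x \<in> X \<and> y \<in> Y \<and> {x, y} \<in> F} = (SIGMA x:X. {y \<in> Y. {x, y} \<in> F})" by auto
  then show ?thesis using assms by (simp add: cross_def)
qed

lemma cross_mono:
  assumes "finite X" "finite Y" "F \<subseteq> F'"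
  shows "cross F X Y \<le> cross F' X Y"
  unfolding cross_def using assms by (intro card_mono finite_cross) auto

lemma card_edges_between:
  assumes "finite X" "finite Y"
  shows "card {f \<in> F. \<exists>x\<in>X. \<exists>y\<in>Y. f = {x, y}} \<le> cross F X Y"
proof -
  have "{f \<in> F. \<exists>x\<in>X. \<exists>y\<in>Y. f = {x, y}} = (\<lambda>(x, y). {x, y}) ` {(x, y). x \<in> X \<and> y \<in> Y \<and> {x, y} \<in> F}"
    by (auto simp: image_iff)
  then show ?thesis unfolding cross_def using finite_cross[OF assms] by (simp add: card_image_le)
qed

lemma cross_same:
  assumes "finite X" "\<And>f. f \<in> F \<Longrightarrow> card f = 2"
  shows "cross F X X = 2 * card {f \<in> F. f \<subseteq> X}"
proof -
  let ?I = "{f \<in> F. f \<subseteq> X}"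
  have finI: "finite ?I" by (rule finite_subset[of _ "Pow X"]) (use assms in auto)
  have eq: "{(x, y). x \<in> X \<and> y \<in> X \<and> {x, y} \<in> F} = (\<Union>f\<in>?I. {(x, y). {x, y} = f})" by auto
  have two: "card {(x, y). {x, y} = f} = 2" if f: "f \<in> ?I" for f
  proof -
    obtain p q where pq: "f = {p, q}" "p \<noteq> q" using f assms(2)[of f] by (auto simp: card_2_iff)
    then have "{(x, y). {x, y} = f} = {(p, q), (q, p)}" by (auto simp: doubleton_eq_iff)
    then show ?thesis using pq by simp
  qed
  then have fin2: "finite {(x, y). {x, y} = f}" if "f \<in> ?I" for f
    using that card.infinite by fastforce
  have "cross F X X = (\<Sum>f\<in>?I. card {(x, y). {x, y} = f})"
    unfolding cross_def eq using finI fin2 by (intro card_UN_disjoint) auto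
  then show ?thesis using two by simp
qed

section \<open>Claw-free graphs of bounded degree\<close>

locale claw_free_graph =
  fixes G :: "'a graph" and d :: nat
  assumes simple: "simple_graph G" and no_claw: "claw_free G" and max_deg: "max_degree G \<le> d"
begin

definition adj :: "'a \<Rightarrow> 'a \<Rightarrow> bool" where "adj x y \<longleftrightarrow> {x, y} \<in> edges G"

definition nbrs :: "'a \<Rightarrow> 'a set" where "nbrs x = {y. adj x y}"

lemma adj_sym: "adj x y \<longleftrightarrow> adj y x"
  by (simp add: adj_def insert_commute)

lemma adj_irrefl [simp]: "\<not> adj x x"
  using simple by (force simp: adj_def simple_graph_def)

lemma adj_verts: "adj x y \<Longrightarrow> x \<in> verts G \<and> y \<in> verts G"
  using simple by (auto simp: adj_def simple_graph_def)

lemma finite_verts: "finite (verts G)"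
  using simple by (simp add: simple_graph_def)

lemma finite_edges: "finite (edges G)"
  using simple by (rule simple_graph_finite_edges)

lemma edge_card: "f \<in> edges G \<Longrightarrow> card f = 2"
  using simple by (simp add: simple_graph_def)

lemma edgeE:
  assumes "f \<in> edges G"
  obtains x y where "f = {x, y}" "adj x y" "x \<noteq> y"
proof -
  obtain x y where "f = {x, y}" "x \<noteq> y" using edge_card[OF assms] by (auto simp: card_2_iff)
  with assms that show ?thesis by (auto simp: adj_def)
qed

lemma nbrs_verts: "nbrs x \<subseteq> verts G"
  using adj_verts by (auto simp: nbrs_def)

lemma finite_nbrs [simp]: "finite (nbrs x)"
  using nbrs_verts finite_verts by (rule finite_subset)

lemma card_nbrs: "card (nbrs x) \<le> d"
proof (cases "x \<in> verts G")
  case True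
  have "card (nbrs x) = card ((\<lambda>y. {x, y}) ` nbrs x)"
    by (rule card_image[symmetric]) (auto simp: inj_on_def doubleton_eq_iff)
  also have "\<dots> \<le> degree G x" unfolding degree_def
    using finite_edges by (intro card_mono) (auto simp: nbrs_def adj_def)
  also have "\<dots> \<le> max_degree G" unfolding max_degree_def
    using finite_verts True by (intro Max_ge) auto
  finally show ?thesis using max_deg by simp
next
  case False
  then have "nbrs x = {}" using adj_verts by (auto simp: nbrs_def)
  then show ?thesis by simp
qed

text \<open>
  The form in which claw-freeness is used throughout: among three neighbours of \<open>z\<close> two are adjacent.
\<close>

lemma claw_freeD:
  assumes "adj z x1" "adj z x2" "adj z x3" "x1 \<noteq> x2" "x1 \<noteq> x3" "x2 \<noteq> x3"
  shows "adj x1 x2 \<or> adj x1 x3 \<or> adj x2 x3"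
proof (rule ccontr)
  assume non: "\<not> ?thesis"
  have zx: "z \<noteq> x1" "z \<noteq> x2" "z \<noteq> x3" using assms(1-3) by auto
  let ?S = "{z, x1, x2, x3}"
  let ?H = "induced_subgraph G ?S"
  define h where "h = (\<lambda>x. if x = z then 0 else if x = x1 then 1 else if x = x2 then 2 else (3::nat))"
  have h: "h z = 0" "h x1 = 1" "h x2 = 2" "h x3 = 3" using zx assms by (auto simp: h_def)
  have S: "?S \<subseteq> verts G" using adj_verts assms by auto
  have verts: "verts ?H = ?S" using S by (auto simp: induced_subgraph_def)
  have edges: "edges ?H = {{z, x1}, {z, x2}, {z, x3}}"
  proof
    show "{{z, x1}, {z, x2}, {z, x3}} \<subseteq> edges ?H"
      using assms by (auto simp: induced_subgraph_def adj_def)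
    show "edges ?H \<subseteq> {{z, x1}, {z, x2}, {z, x3}}"
    proof
      fix f assume "f \<in> edges ?H"
      then have f: "f \<in> edges G" "f \<subseteq> ?S" by (auto simp: induced_subgraph_def)
      then obtain x y where "f = {x, y}" "adj x y" by (auto elim: edgeE)
      then show "f \<in> {{z, x1}, {z, x2}, {z, x3}}"
        using f(2) non adj_sym adj_irrefl by (auto simp: insert_commute)
    qed
  qed
  have "isomorphic ?H claw" unfolding isomorphic_def
  proof (intro exI conjI)
    show "bij_betw h (verts ?H) (verts claw)"
      unfolding verts bij_betw_def using h zx assms
      by (auto simp: claw_def inj_on_def)
    show "(\<lambda>e. h ` e) ` edges ?H = edges claw"
      unfolding edges using h by (simp add: claw_def)
  qed
  then show False using no_claw S by (auto simp: claw_free_def contains_induced_def)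
qed

end

section \<open>The neighbourhood of an edge\<close>

text \<open>
  The vertices \<open>u\<close> and \<open>v\<close> play symmetric roles, exchanging \<open>A\<close> with \<open>B\<close>; the locale is
  instantiated with the two swapped to transfer facts from \<open>A\<close> to \<open>B\<close>.
\<close>

locale edge_neighbourhood = claw_free_graph +
  fixes u v :: 'a
  assumes uv: "adj u v"
begin

definition A where "A = nbrs u - nbrs v - {v}"
definition B where "B = nbrs v - nbrs u - {u}"
definition C where "C = nbrs u \<inter> nbrs v"
definition Z where "Z = verts G - nbrs u - nbrs v"

abbreviation S where "S \<equiv> A \<union> B \<union> C"

lemma flip: "edge_neighbourhood G d v u"
  by unfold_locales (simp add: uv adj_sym)

lemma flip_sets:
  "edge_neighbourhood.A G v u = B" "edge_neighbourhood.B G v u = A"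
  "edge_neighbourhood.C G v u = C" "edge_neighbourhood.Z G v u = Z"
proof -
  interpret flip: edge_neighbourhood G d v u by (rule flip)
  show "flip.A = B" "flip.B = A" "flip.C = C" "flip.Z = Z"
    by (auto simp: flip.A_def A_def flip.B_def B_def flip.C_def C_def flip.Z_def Z_def)
qed

lemma finite_sets [simp]: "finite A" "finite B" "finite C" "finite Z"
  using finite_verts by (auto simp: A_def B_def C_def Z_def)

lemma memA: "x \<in> A \<longleftrightarrow> adj u x \<and> \<not> adj v x \<and> x \<noteq> v"
  and memB: "x \<in> B \<longleftrightarrow> adj v x \<and> \<not> adj u x \<and> x \<noteq> u"
  and memC: "x \<in> C \<longleftrightarrow> adj u x \<and> adj v x"
  and memZ: "x \<in> Z \<longleftrightarrow> x \<in> verts G \<and> \<not> adj u x \<and> \<not> adj v x"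
  by (auto simp: A_def B_def C_def Z_def nbrs_def)

lemma memS: "x \<in> S \<longleftrightarrow> x \<noteq> u \<and> x \<noteq> v \<and> (adj u x \<or> adj v x)"
  using uv adj_sym by (auto simp: memA memB memC)

lemma disjoint_sets:
  "A \<inter> B = {}" "A \<inter> C = {}" "B \<inter> C = {}" "A \<inter> Z = {}" "B \<inter> Z = {}" "C \<inter> Z = {}"
  "u \<notin> A" "u \<notin> B" "u \<notin> C" "u \<notin> Z" "v \<notin> A" "v \<notin> B" "v \<notin> C" "v \<notin> Z"
  using uv adj_sym[of u v] by (auto simp: memA memB memC memZ)

text \<open>
  Two nonadjacent members would form a claw at \<open>u\<close> together with \<open>v\<close>.
\<close>

lemma clique_A: "x \<in> A \<Longrightarrow> y \<in> A \<Longrightarrow> x \<noteq> y \<Longrightarrow> adj x y"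
  using claw_freeD[of u v x y] uv by (auto simp: memA)

lemma clique_B: "x \<in> B \<Longrightarrow> y \<in> B \<Longrightarrow> x \<noteq> y \<Longrightarrow> adj x y"
  using edge_neighbourhood.clique_A[OF flip] by (simp add: flip_sets)

text \<open>
  The third leaf of the claw is whichever of \<open>u\<close> and \<open>v\<close> is adjacent to \<open>s\<close>: it has no neighbour in \<open>Z\<close>.
\<close>

lemma outer_clique:
  assumes "s \<in> S" "x \<in> Z" "y \<in> Z" "adj s x" "adj s y" "x \<noteq> y"
  shows "adj x y"
proof -
  obtain r where r: "r = u \<or> r = v" "adj r s" using assms(1) memS by blast
  have "\<not> adj r x" "\<not> adj r y" "r \<noteq> x" "r \<noteq> y" using r assms(2,3) disjoint_sets by (auto simp: memZ)
  then show ?thesis using claw_freeD[of s r x y] assms r(2) adj_sym[of r s] by auto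
qed

text \<open>
  For members of \<open>S\<close> this says that they lie in the same one of \<open>A\<close>, \<open>B\<close>, \<open>C\<close>. Phrased through
  adjacency to \<open>u\<close> and \<open>v\<close>, it allows the three pairs of sets to be treated at once.
\<close>

definition same_side where
  "same_side s s' \<longleftrightarrow> (adj u s \<longleftrightarrow> adj u s') \<and> (adj v s \<longleftrightarrow> adj v s')"

text \<open>
  One of \<open>u\<close> and \<open>v\<close> is adjacent to exactly one of \<open>s\<close> and \<open>s'\<close>, say to \<open>s'\<close>. At \<open>s'\<close> the neighbours
  \<open>r\<close>, \<open>s\<close>, \<open>x'\<close> must not form a claw, and \<open>r\<close> is adjacent to neither of the other two.
\<close>

lemma outer_transfer:
  assumes "s \<in> S" "s' \<in> S" "\<not> same_side s s'" "adj s s'" "x \<in> Z" "x' \<in> Z" "adj s x" "adj s' x'"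
  shows "adj s x' \<or> adj s' x"
proof -
  have main: "adj p y" if "p \<in> S" "r = u \<or> r = v" "adj r q" "\<not> adj r p" "adj q p" "y \<in> Z" "adj q y" for r p q y
  proof -
    have "\<not> adj r y" "r \<noteq> y" "r \<noteq> p" "p \<noteq> y" using that disjoint_sets by (auto simp: memZ)
    then show ?thesis using claw_freeD[of q r p y] that adj_sym[of r q] by auto
  qed
  obtain r where r: "r = u \<or> r = v" "adj r s \<noteq> adj r s'" using assms(3) by (auto simp: same_side_def)
  then show ?thesis
    using main[of s r s' x'] main[of s' r s x] assms adj_sym[of s s'] by blast
qed

lemma clique_edges:
  assumes "finite X" "\<And>x y. x \<in> X \<Longrightarrow> y \<in> X \<Longrightarrow> x \<noteq> y \<Longrightarrow> adj x y"
  shows "card {f \<in> edges G. f \<subseteq> X} = card X choose 2"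
proof -
  have "f \<in> edges G" if "f \<subseteq> X" "card f = 2" for f
    using that assms(2) by (auto simp: card_2_iff adj_def)
  then have "{f \<in> edges G. f \<subseteq> X} = {f. f \<subseteq> X \<and> card f = 2}" using edge_card by auto
  then show ?thesis using n_subsets[OF assms(1)] by simp
qed

lemma card_edges_A: "card {f \<in> edges G. f \<subseteq> A} = card A choose 2"
  and card_edges_B: "card {f \<in> edges G. f \<subseteq> B} = card B choose 2"
  using clique_edges clique_A clique_B by auto

abbreviation (input) "E \<equiv> edges G"
abbreviation eC where "eC \<equiv> card {f \<in> edges G. f \<subseteq> C}"

lemma cross_degree:
  assumes "finite X" "finite Y"
  shows "cross (edges G) X Y \<le> d * card X"
proof -
  have "card {y \<in> Y. {x, y} \<in> edges G} \<le> d" for x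
  proof -
    have "card {y \<in> Y. {x, y} \<in> edges G} \<le> card (nbrs x)"
      by (intro card_mono finite_nbrs) (auto simp: nbrs_def adj_def)
    then show ?thesis using card_nbrs[of x] by linarith
  qed
  then have "cross (edges G) X Y \<le> (\<Sum>x\<in>X. d)"
    unfolding cross_sum[OF assms] by (intro sum_mono)
  then show ?thesis by (simp add: mult.commute)
qed

lemma cross_single:
  assumes "finite X" "\<And>x. x \<in> X \<Longrightarrow> adj r x"
  shows "cross (edges G) X {r} = card X"
proof -
  have "{(x, y). x \<in> X \<and> y \<in> {r} \<and> {x, y} \<in> edges G} = X \<times> {r}"
    using assms(2) adj_sym by (auto simp: adj_def)
  then show ?thesis by (simp add: cross_def card_cartesian_product)
qed

lemma card_sides: "card A + card C + 1 \<le> d" "card B + card C + 1 \<le> d"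
proof -
  have "card (insert v (A \<union> C)) \<le> card (nbrs u)"
    using uv by (intro card_mono finite_nbrs) (auto simp: A_def C_def nbrs_def)
  then show "card A + card C + 1 \<le> d"
    using card_nbrs[of u] disjoint_sets by (simp add: card_Un_disjoint)
  have "card (insert u (B \<union> C)) \<le> card (nbrs v)"
    using uv adj_sym[of u v] by (intro card_mono finite_nbrs) (auto simp: B_def C_def nbrs_def)
  then show "card B + card C + 1 \<le> d"
    using card_nbrs[of v] disjoint_sets by (simp add: card_Un_disjoint)
qed

text \<open>
  The degree sum over \<open>A\<close>, split by the set that contains the other end; the first summand counts
  the edges to \<open>u\<close>.
\<close>

lemma degree_sum_A:
  "card A + 2 * (card A choose 2) + cross E A B + cross E A C + cross E A Z \<le> d * card A"
proof -
  have "cross E A (C \<union> Z) = cross E A C + cross E A Z"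
    "cross E A (B \<union> (C \<union> Z)) = cross E A B + cross E A (C \<union> Z)"
    "cross E A (A \<union> (B \<union> (C \<union> Z))) = cross E A A + cross E A (B \<union> (C \<union> Z))"
    "cross E A ({u} \<union> (A \<union> (B \<union> (C \<union> Z)))) = cross E A {u} + cross E A (A \<union> (B \<union> (C \<union> Z)))"
    by (rule cross_Un; use disjoint_sets in \<open>simp add: Int_Un_distrib\<close>)+
  moreover have "cross E A ({u} \<union> (A \<union> (B \<union> (C \<union> Z)))) \<le> d * card A"
    by (rule cross_degree) auto
  moreover have "cross E A {u} = card A" by (rule cross_single) (auto simp: memA)
  moreover have "cross E A A = 2 * (card A choose 2)"
    using cross_same[of A E] edge_card card_edges_A by simp
  ultimately show ?thesis by linarith
qed

lemma degree_sum_B: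
  "card B + 2 * (card B choose 2) + cross E A B + cross E B C + cross E B Z \<le> d * card B"
  using edge_neighbourhood.degree_sum_A[OF flip] cross_commute[of E A B] by (simp add: flip_sets)

lemma degree_sum_C:
  "2 * card C + 2 * eC + cross E A C + cross E B C + cross E C Z \<le> d * card C"
proof -
  have "u \<noteq> v" using uv by auto
  then have "cross E C (B \<union> Z) = cross E C B + cross E C Z"
    "cross E C (A \<union> (B \<union> Z)) = cross E C A + cross E C (B \<union> Z)"
    "cross E C (C \<union> (A \<union> (B \<union> Z))) = cross E C C + cross E C (A \<union> (B \<union> Z))"
    "cross E C ({v} \<union> (C \<union> (A \<union> (B \<union> Z)))) = cross E C {v} + cross E C (C \<union> (A \<union> (B \<union> Z)))"
    "cross E C ({u} \<union> ({v} \<union> (C \<union> (A \<union> (B \<union> Z))))) =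
      cross E C {u} + cross E C ({v} \<union> (C \<union> (A \<union> (B \<union> Z))))"
    by (intro cross_Un; use disjoint_sets in \<open>simp add: Int_Un_distrib Int_commute\<close>)+
  moreover have "cross E C ({u} \<union> ({v} \<union> (C \<union> (A \<union> (B \<union> Z))))) \<le> d * card C"
    by (rule cross_degree) auto
  moreover have "cross E C {u} = card C" "cross E C {v} = card C" by (auto intro!: cross_single simp: memC)
  moreover have "cross E C C = 2 * eC"
    using cross_same[of C E] edge_card by simp
  ultimately show ?thesis using cross_commute[of E A C] cross_commute[of E B C] by linarith
qed

text \<open>
  The edges in conflict with \<open>{u, v}\<close> are those that meet \<open>{u, v} \<union> S\<close>. The bound is stated for a subset \<open>F\<close>, and
  counts within \<open>F\<close> only the edges inside \<open>A\<close> or \<open>B\<close> and the edges to \<open>Z\<close>: these are the edges of which a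
  pairwise conflicting set is shown to miss many.
\<close>

lemma card_conflicting:
  assumes F: "F \<subseteq> {f \<in> edges G. conflict G {u, v} f}"
  shows "card F \<le> 1 + card A + card B + 2 * card C
    + card {f \<in> F. f \<subseteq> A} + card {f \<in> F. f \<subseteq> B} + eC
    + cross E A B + cross E A C + cross E B C + (cross F A Z + cross F B Z + cross F C Z)"
proof -
  have FE: "F \<subseteq> edges G" using F by auto
  have finF: "finite F" using FE finite_edges by (rule finite_subset)
  let ?I = "\<lambda>F X Y. {f \<in> F. \<exists>x\<in>X. \<exists>y\<in>Y. f = {x, y}}"
  let ?cover = "{{u, v}} \<union> (\<lambda>x. {u, x}) ` (A \<union> C) \<union> (\<lambda>x. {v, x}) ` (B \<union> C)
     \<union> {f \<in> F. f \<subseteq> A} \<union> {f \<in> F. f \<subseteq> B} \<union> {f \<in> edges G. f \<subseteq> C}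
     \<union> ?I E A B \<union> ?I E A C \<union> ?I E B C \<union> (?I F A Z \<union> ?I F B Z \<union> ?I F C Z)"
  have "F \<subseteq> ?cover"
  proof
    fix f assume f: "f \<in> F"
    then have fE: "f \<in> edges G" "conflict G {u, v} f" using F by auto
    obtain p where p: "p \<in> f" "adj u p \<or> adj v p"
      using fE(2) uv adj_sym[of u v] by (auto simp: conflict_def adj_def)
    obtain x y where xy: "f = {x, y}" "adj x y" "x \<noteq> y" using fE(1) by (rule edgeE)
    have "f = {p, if p = x then y else x} \<and> adj p (if p = x then y else x) \<and> p \<noteq> (if p = x then y else x)"
      using p(1) xy adj_sym[of x y] by auto
    then obtain q where q: "f = {p, q}" "adj p q" "p \<noteq> q" by blast
    have qV: "q \<in> verts G" using adj_verts q(2) by blast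
    have part: "p = u \<or> p = v \<or> p \<in> A \<or> p \<in> B \<or> p \<in> C"
      "q = u \<or> q = v \<or> q \<in> A \<or> q \<in> B \<or> q \<in> C \<or> q \<in> Z"
      using p(2) qV by (auto simp: memA memB memC memZ)
    have u: "{u, x} \<in> ?cover" if "adj u x" for x
      using that by (cases "adj v x"; cases "x = v") (auto simp: memA memC)
    have v: "{v, x} \<in> ?cover" if "adj v x" for x
      using that by (cases "adj u x"; cases "x = u") (auto simp: memB memC insert_commute)
    have sym: "{p, q} = {q, p}" by (rule insert_commute)
    show "f \<in> ?cover"
    proof (cases "{p, q} \<inter> {u, v} = {}")
      case False
      then consider "p = u" | "p = v" | "q = u" | "q = v" by auto
      then show ?thesis
      proof cases
        case 1 then show ?thesis using u[of q] q by simp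
      next
        case 2 then show ?thesis using v[of q] q by simp
      next
        case 3 then show ?thesis using u[of p] q sym adj_sym[of p q] by simp
      next
        case 4 then show ?thesis using v[of p] q sym adj_sym[of p q] by simp
      qed
    next
      case True
      then have pq: "p \<in> A \<or> p \<in> B \<or> p \<in> C" "q \<in> A \<or> q \<in> B \<or> q \<in> C \<or> q \<in> Z" using part by auto
      have between: "f \<in> ?I F' X Y" if "f \<in> F'" "p \<in> X \<and> q \<in> Y \<or> q \<in> X \<and> p \<in> Y" for F' X Y
        using that q(1) sym by blast
      have inside: "f \<in> {f \<in> F'. f \<subseteq> X}" if "f \<in> F'" "p \<in> X" "q \<in> X" for F' X
        using that q(1) by simp
      from pq show ?thesis
        using between[OF fE(1), of A B] between[OF fE(1), of A C] between[OF fE(1), of B C]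
          between[OF f, of A Z] between[OF f, of B Z] between[OF f, of C Z]
          inside[OF f, of A] inside[OF f, of B] inside[OF fE(1), of C]
        by (elim disjE) (simp_all only: Un_iff simp_thms)
    qed
  qed
  moreover have "finite ?cover" using finF finite_edges by auto
  ultimately have "card F \<le> card ?cover" by (intro card_mono)
  also have "\<dots> \<le> 1 + (card A + card C) + (card B + card C)
    + card {f \<in> F. f \<subseteq> A} + card {f \<in> F. f \<subseteq> B} + eC
    + cross E A B + cross E A C + cross E B C + (cross F A Z + cross F B Z + cross F C Z)"
  proof (intro card_Un_bound order_refl card_edges_between finite_sets)
    show "card {{u, v}} \<le> 1" by simp
    show "card ((\<lambda>x. {u, x}) ` (A \<union> C)) \<le> card A + card C"
      using card_image_le[of "A \<union> C"] card_Un_le[of A C] by (meson finite_UnI finite_sets order_trans)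
    show "card ((\<lambda>x. {v, x}) ` (B \<union> C)) \<le> card B + card C"
      using card_image_le[of "B \<union> C"] card_Un_le[of B C] by (meson finite_UnI finite_sets order_trans)
  qed
  finally show ?thesis by simp
qed

end

section \<open>Pairwise conflicting edges near a fixed edge\<close>

locale clique_of_conflicts = edge_neighbourhood +
  fixes P :: "'a set set"
  assumes P_sub: "P \<subseteq> {f \<in> edges G. conflict G {u, v} f}"
    and P_conf: "\<And>f g. f \<in> P \<Longrightarrow> g \<in> P \<Longrightarrow> conflict G f g"
begin

lemma flip_conflicts: "clique_of_conflicts G d v u P"
  using P_sub P_conf flip
  by (simp add: clique_of_conflicts_def clique_of_conflicts_axioms_def insert_commute)

lemma P_edges: "P \<subseteq> edges G"
  using P_sub by auto

lemma P_adj: "{x, y} \<in> P \<Longrightarrow> adj x y"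
  using P_edges by (auto simp: adj_def)

lemma finite_P: "finite P"
  using P_edges finite_edges by (rule finite_subset)

lemma P_conflict:
  assumes "{x, y} \<in> P" "{z, w} \<in> P"
  shows "x = z \<or> x = w \<or> y = z \<or> y = w \<or> adj x z \<or> adj x w \<or> adj y z \<or> adj y w"
  using P_conf[OF assms] by (auto simp: conflict_def adj_def)

text \<open>
  The vertices outside the neighbourhood of \<open>{u, v}\<close> at which edges of \<open>P\<close> from \<open>T\<close> arrive.
\<close>

definition ends :: "'a set \<Rightarrow> 'a set" where
  "ends T = {x \<in> Z. \<exists>s\<in>T. {s, x} \<in> P}"

lemma finite_ends [simp]: "finite (ends T)"
  by (simp add: ends_def)

lemma ends_Un: "ends (T \<union> T') = ends T \<union> ends T'"
  by (auto simp: ends_def)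

text \<open>
  Unless \<open>x\<close> and \<open>x'\<close> coincide or cause the conflict themselves, the conflict shows, possibly after a transfer, that both \<open>x\<close> and \<open>x'\<close> are neighbours of \<open>s\<close> or both are neighbours of \<open>s'\<close>, and such vertices form a clique.
\<close>

lemma ends_of_different_sides:
  assumes "s \<in> S" "s' \<in> S" "\<not> same_side s s'" "x \<in> Z" "x' \<in> Z" "{s, x} \<in> P" "{s', x'} \<in> P"
  shows "x = x' \<or> adj x x'"
proof -
  have ne: "s \<noteq> s'" "s \<noteq> x'" "x \<noteq> s'" using assms(1-5) disjoint_sets by (auto simp: same_side_def)
  have ad: "adj s x" "adj s' x'" using P_adj assms by auto
  have cl: "x = x' \<or> adj x x'" if "adj s x' \<or> adj s' x"
    using that outer_clique[of s x x'] outer_clique[of s' x x'] assms ad by blast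
  have tr: "adj s x' \<or> adj s' x" if "adj s s'"
    using outer_transfer[OF assms(1-3) that assms(4,5) ad] .
  show ?thesis using P_conflict[OF assms(6,7)] ne cl tr adj_sym[of x s'] by blast
qed

text \<open>
  If the conflict is an edge from \<open>a\<close> to the vertex \<open>s\<close> of \<open>B \<union> C\<close> that leads to \<open>x\<close>, then \<open>v\<close>, \<open>a\<close>, \<open>x\<close>
  are neighbours of \<open>s\<close>, and only \<open>a\<close> and \<open>x\<close> can be adjacent.
\<close>

lemma inner_edge_hits_A:
  assumes "a \<in> A" "a' \<in> A" "{a, a'} \<in> P" "x \<in> ends (B \<union> C)"
  shows "adj a x \<or> adj a' x"
proof -
  obtain s where s: "s \<in> B \<union> C" "{s, x} \<in> P" "x \<in> Z" using assms(4) by (auto simp: ends_def)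
  have ad: "adj s x" "adj s v" using P_adj[OF s(2)] s(1) adj_sym[of s v] by (auto simp: memB memC)
  have tr: "adj p x" if "p \<in> A" "adj p s" for p
    using claw_freeD[of s v p x] that ad s(3) adj_sym[of p s] disjoint_sets by (auto simp: memA memZ)
  have "a \<noteq> s" "a \<noteq> x" "a' \<noteq> s" "a' \<noteq> x" using assms(1,2) s disjoint_sets by auto
  then show ?thesis using P_conflict[OF assms(3) s(2)] tr assms(1,2) by blast
qed

lemma inner_edge_hits_B:
  assumes "b \<in> B" "b' \<in> B" "{b, b'} \<in> P" "x \<in> ends (A \<union> C)"
  shows "adj b x \<or> adj b' x"
  using clique_of_conflicts.inner_edge_hits_A[OF flip_conflicts] assms
  by (simp add: flip_sets clique_of_conflicts.ends_def[OF flip_conflicts] ends_def)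

lemma side_cases:
  assumes "s \<in> S" "s' \<in> S"
  shows "same_side s s' \<longleftrightarrow> (s \<in> A \<longleftrightarrow> s' \<in> A) \<and> (s \<in> B \<longleftrightarrow> s' \<in> B) \<and> (s \<in> C \<longleftrightarrow> s' \<in> C)"
  using assms memS by (auto simp: same_side_def memA memB memC)

text \<open>
  Independent ends are all reached from the same one of the sets \<open>A\<close>, \<open>B\<close>, \<open>C\<close>. An end reached from
  another one, which exists by assumption, is adjacent to all three: a claw.
\<close>

lemma ends_no_independent_triple:
  assumes ne: "ends C \<noteq> {}" "ends (A \<union> B) \<noteq> {}"
    and x: "x1 \<in> ends S" "x2 \<in> ends S" "x3 \<in> ends S" "x1 \<noteq> x2" "x1 \<noteq> x3" "x2 \<noteq> x3"
  shows "adj x1 x2 \<or> adj x1 x3 \<or> adj x2 x3"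
proof (rule ccontr)
  assume non: "\<not> ?thesis"
  obtain s1 where s1: "s1 \<in> S" "{s1, x1} \<in> P" "x1 \<in> Z" using x(1) by (auto simp: ends_def)
  obtain s2 where s2: "s2 \<in> S" "{s2, x2} \<in> P" "x2 \<in> Z" using x(2) by (auto simp: ends_def)
  obtain s3 where s3: "s3 \<in> S" "{s3, x3} \<in> P" "x3 \<in> Z" using x(3) by (auto simp: ends_def)
  have same: "same_side s1 s2" "same_side s1 s3"
    using ends_of_different_sides[OF s1(1) s2(1) _ s1(3) s2(3) s1(2) s2(2)]
      ends_of_different_sides[OF s1(1) s3(1) _ s1(3) s3(3) s1(2) s3(2)] non x by blast+
  obtain s y where s: "s \<in> S" "{s, y} \<in> P" "y \<in> Z" "\<not> same_side s s1"
  proof (cases "s1 \<in> C")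
    case True
    obtain s y where "s \<in> A \<union> B" "{s, y} \<in> P" "y \<in> Z" using ne(2) by (auto simp: ends_def)
    moreover have "\<not> same_side s s1"
      using calculation(1) True s1(1) disjoint_sets side_cases[of s s1] by blast
    ultimately show ?thesis using that by blast
  next
    case False
    obtain s y where "s \<in> C" "{s, y} \<in> P" "y \<in> Z" using ne(1) by (auto simp: ends_def)
    moreover have "\<not> same_side s s1"
      using calculation(1) False s1(1) side_cases[of s s1] by blast
    ultimately show ?thesis using that by blast
  qed
  have diff: "\<not> same_side s s2" "\<not> same_side s s3" using s(4) same by (auto simp: same_side_def)
  have y: "y = x1 \<or> adj y x1" "y = x2 \<or> adj y x2" "y = x3 \<or> adj y x3"
    using ends_of_different_sides[OF s(1) s1(1) s(4) s(3) s1(3) s(2) s1(2)]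
      ends_of_different_sides[OF s(1) s2(1) diff(1) s(3) s2(3) s(2) s2(2)]
      ends_of_different_sides[OF s(1) s3(1) diff(2) s(3) s3(3) s(2) s3(2)] by auto
  then have "adj y x1" "adj y x2" "adj y x3" using non x(4-6) adj_sym[of x2 x1] adj_sym[of x3 x1] adj_sym[of x3 x2] by auto
  then show False using claw_freeD[of y x1 x2 x3] non x(4-6) by blast
qed

definition pA where "pA = card {f \<in> P. f \<subseteq> A}"
definition pB where "pB = card {f \<in> P. f \<subseteq> B}"

lemma pA_le: "pA \<le> card A choose 2"
proof -
  have "pA \<le> card {f \<in> edges G. f \<subseteq> A}"
    unfolding pA_def using P_edges finite_edges by (intro card_mono) auto
  then show ?thesis by (simp add: card_edges_A)
qed

text \<open>
  Every edge of \<open>P\<close> inside \<open>X\<close> contains a neighbour of \<open>z\<close>, so the pairs of non-neighbours are lost.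
\<close>

lemma inside_avoiding:
  assumes "finite X" "\<And>x y. x \<in> X \<Longrightarrow> y \<in> X \<Longrightarrow> {x, y} \<in> P \<Longrightarrow> adj x z \<or> adj y z"
  shows "card {f \<in> P. f \<subseteq> X} + (card (X - nbrs z) choose 2) \<le> card X choose 2"
proof -
  let ?T = "\<lambda>X. {f. f \<subseteq> X \<and> card f = 2}"
  have fin: "finite (?T X)" by (rule finite_subset[of _ "Pow X"]) (use assms in auto)
  have sub: "?T (X - nbrs z) \<subseteq> ?T X" by auto
  have "{f \<in> P. f \<subseteq> X} \<subseteq> ?T X - ?T (X - nbrs z)"
  proof
    fix f assume f: "f \<in> {f \<in> P. f \<subseteq> X}"
    then have "f \<in> edges G" using P_edges by auto
    then obtain x y where xy: "f = {x, y}" by (rule edgeE)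
    then have "adj x z \<or> adj y z" using assms(2) f by auto
    then have "\<not> f \<subseteq> X - nbrs z" using xy adj_sym[of x z] adj_sym[of y z] by (auto simp: nbrs_def)
    then show "f \<in> ?T X - ?T (X - nbrs z)" using f edge_card[OF \<open>f \<in> edges G\<close>] by auto
  qed
  then have "card {f \<in> P. f \<subseteq> X} \<le> card (?T X - ?T (X - nbrs z))"
    using fin by (intro card_mono) auto
  also have "\<dots> = card (?T X) - card (?T (X - nbrs z))"
    using fin sub by (intro card_Diff_subset) (auto intro: finite_subset)
  finally have "card {f \<in> P. f \<subseteq> X} + card (?T (X - nbrs z)) \<le> card (?T X)"
    using card_mono[OF fin sub] by linarith
  then show ?thesis using assms(1) by (simp add: n_subsets)
qed

text \<open>
  Each edge of \<open>P\<close> inside \<open>X\<close> needs a neighbour of \<open>z\<close> and a neighbour of \<open>z'\<close>; as no vertex is both, it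
  joins the two neighbourhoods.
\<close>

lemma inside_two_hits:
  assumes "finite X"
    and hit: "\<And>x y. x \<in> X \<Longrightarrow> y \<in> X \<Longrightarrow> {x, y} \<in> P \<Longrightarrow> (adj x z \<or> adj y z) \<and> (adj x z' \<or> adj y z')"
    and disj: "X \<inter> nbrs z \<inter> nbrs z' = {}"
  shows "card {f \<in> P. f \<subseteq> X} \<le> card (X \<inter> nbrs z) * card (X \<inter> nbrs z')"
proof -
  let ?R = "(X \<inter> nbrs z) \<times> (X \<inter> nbrs z')"
  have "{f \<in> P. f \<subseteq> X} \<subseteq> (\<lambda>(x, y). {x, y}) ` ?R"
  proof
    fix f assume f: "f \<in> {f \<in> P. f \<subseteq> X}"
    then have "f \<in> edges G" using P_edges by auto
    then obtain x y where xy: "f = {x, y}" by (rule edgeE)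
    have "(x \<in> nbrs z \<or> y \<in> nbrs z) \<and> (x \<in> nbrs z' \<or> y \<in> nbrs z')" "x \<in> X" "y \<in> X"
      using hit[of x y] f xy adj_sym by (auto simp: nbrs_def)
    then have "(x, y) \<in> ?R \<or> (y, x) \<in> ?R" using disj by blast
    moreover have "f = {y, x}" using xy by auto
    ultimately show "f \<in> (\<lambda>(x, y). {x, y}) ` ?R" using xy by (auto simp: image_iff)
  qed
  then have "card {f \<in> P. f \<subseteq> X} \<le> card ((\<lambda>(x, y). {x, y}) ` ?R)"
    using assms(1) by (intro card_mono) auto
  also have "\<dots> \<le> card ?R" using assms(1) by (intro card_image_le) auto
  finally show ?thesis by (simp add: card_cartesian_product)
qed

text \<open>
  Each pair of an edge of \<open>P\<close> inside \<open>A\<close> and an edge of \<open>P\<close> inside \<open>B\<close> is joined by an edge of \<open>G\<close>, and an edge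
  between \<open>A\<close> and \<open>B\<close> serves at most \<open>(card A - 1) * (card B - 1)\<close> such pairs.
\<close>

lemma inner_product_bound: "pA * pB \<le> cross (edges G) A B * ((card A - 1) * (card B - 1))"
proof -
  let ?T = "{(a, b). a \<in> A \<and> b \<in> B \<and> {a, b} \<in> edges G}"
  have star: "card {f \<in> P. f \<subseteq> X \<and> x \<in> f} \<le> card X - 1" if "finite X" "x \<in> X" for X x
  proof -
    have "{f \<in> P. f \<subseteq> X \<and> x \<in> f} \<subseteq> (\<lambda>y. {x, y}) ` (X - {x})"
    proof
      fix f assume f: "f \<in> {f \<in> P. f \<subseteq> X \<and> x \<in> f}"
      then have "f \<in> edges G" using P_edges by auto
      then obtain p q where "f = {p, q}" "p \<noteq> q" by (elim edgeE)
      then show "f \<in> (\<lambda>y. {x, y}) ` (X - {x})" using f by (auto simp: image_iff insert_commute)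
    qed
    then have "card {f \<in> P. f \<subseteq> X \<and> x \<in> f} \<le> card ((\<lambda>y. {x, y}) ` (X - {x}))"
      using that by (intro card_mono) auto
    also have "\<dots> \<le> card (X - {x})" using that by (intro card_image_le) auto
    finally show ?thesis using that by (simp add: card_Diff_singleton)
  qed
  let ?W = "\<lambda>(a, b). {f \<in> P. f \<subseteq> A \<and> a \<in> f} \<times> {g \<in> P. g \<subseteq> B \<and> b \<in> g}"
  have finT: "finite ?T" by (rule finite_cross) auto
  have "{f \<in> P. f \<subseteq> A} \<times> {g \<in> P. g \<subseteq> B} \<subseteq> (\<Union>t\<in>?T. ?W t)"
  proof
    fix h assume "h \<in> {f \<in> P. f \<subseteq> A} \<times> {g \<in> P. g \<subseteq> B}"
    then obtain f g where h: "h = (f, g)" "f \<in> P" "f \<subseteq> A" "g \<in> P" "g \<subseteq> B" by auto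
    obtain a b where "a \<in> f" "b \<in> g" "a = b \<or> {a, b} \<in> edges G"
      using P_conf[OF h(2,4)] by (auto simp: conflict_def)
    moreover have "a \<noteq> b" using calculation h disjoint_sets by blast
    ultimately show "h \<in> (\<Union>t\<in>?T. ?W t)" using h by blast
  qed
  then have "card ({f \<in> P. f \<subseteq> A} \<times> {g \<in> P. g \<subseteq> B}) \<le> card (\<Union>t\<in>?T. ?W t)"
    using finT finite_P by (intro card_mono) auto
  also have "\<dots> \<le> (\<Sum>t\<in>?T. card (?W t))" by (rule card_UN_le[OF finT])
  also have "\<dots> \<le> (\<Sum>t\<in>?T. (card A - 1) * (card B - 1))"
  proof (rule sum_mono)
    fix t assume "t \<in> ?T"
    then obtain a b where t: "t = (a, b)" "a \<in> A" "b \<in> B" by auto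
    show "card (?W t) \<le> (card A - 1) * (card B - 1)"
      using star[of A a] star[of B b] t by (simp add: card_cartesian_product mult_le_mono)
  qed
  finally show ?thesis by (simp add: card_cartesian_product pA_def pB_def cross_def)
qed

lemma outer_edges_at_ends:
  "cross P A Z + cross P B Z + cross P C Z = (\<Sum>x\<in>ends S. card {s \<in> S. {s, x} \<in> P})"
proof -
  have un: "cross P Z (A \<union> B) = cross P Z A + cross P Z B"
    "cross P Z (A \<union> B \<union> C) = cross P Z (A \<union> B) + cross P Z C"
    by (rule cross_Un; use disjoint_sets in \<open>simp add: Int_Un_distrib2\<close>)+
  have "cross P A Z + cross P B Z + cross P C Z = cross P Z S"
    using un cross_commute[of P A Z] cross_commute[of P B Z] cross_commute[of P C Z] by linarith
  also have "\<dots> = (\<Sum>x\<in>Z. card {s \<in> S. {s, x} \<in> P})"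
    by (simp add: cross_sum insert_commute)
  also have "\<dots> = (\<Sum>x\<in>ends S. card {s \<in> S. {s, x} \<in> P})"
  proof (rule sum.mono_neutral_right)
    show "\<forall>x\<in>Z - ends S. card {s \<in> S. {s, x} \<in> P} = 0"
    proof
      fix x assume "x \<in> Z - ends S"
      then have "{s \<in> S. {s, x} \<in> P} = {}" unfolding ends_def by blast
      then show "card {s \<in> S. {s, x} \<in> P} = 0" by (simp only: card.empty)
    qed
  qed (auto simp: ends_def)
  finally show ?thesis .
qed

text \<open>
  \<open>Y\<close> collects neighbours of the end in \<open>S\<close> that are not joined to it by edges of \<open>P\<close>.
\<close>

lemma end_degree:
  assumes "x \<in> ends S" "{s \<in> S. {s, x} \<in> P} \<inter> Y = {}" "Y \<subseteq> S \<inter> nbrs x"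
  shows "card {s \<in> S. {s, x} \<in> P} + card {y \<in> ends S. adj x y} + card Y \<le> d"
proof -
  let ?Q = "{s \<in> S. {s, x} \<in> P}" and ?K = "{y \<in> ends S. adj x y}"
  have fin: "finite ?Q" "finite ?K" "finite Y"
    using assms(3) finite_subset[of Y S] by auto
  have d1: "?K \<subseteq> Z" by (auto simp: ends_def)
  have "S \<inter> Z = {}" using disjoint_sets by (simp add: Int_Un_distrib2)
  then have "?K \<inter> S = {}" using d1 by blast
  then have "?K \<inter> Y = {}" "?Q \<inter> ?K = {}" using assms(3) by auto
  then have "(?Q \<union> ?K) \<inter> Y = {}" "?Q \<inter> ?K = {}" using assms(2) by (auto simp: Int_Un_distrib2)
  then have "card (?Q \<union> ?K \<union> Y) = card ?Q + card ?K + card Y"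
    using fin by (simp add: card_Un_disjoint)
  moreover have "?Q \<union> ?K \<union> Y \<subseteq> nbrs x"
  proof -
    have "s \<in> nbrs x" if "{s, x} \<in> P" for s using P_adj[OF that] adj_sym[of s x] by (simp add: nbrs_def)
    moreover have "?K \<subseteq> nbrs x" by (auto simp: nbrs_def)
    ultimately show ?thesis using assms(3) by blast
  qed
  then have "card (?Q \<union> ?K \<union> Y) \<le> card (nbrs x)" by (intro card_mono finite_nbrs)
  ultimately show ?thesis using card_nbrs[of x] by linarith
qed

lemma pB_le: "pB \<le> card B choose 2"
  using clique_of_conflicts.pA_le[OF flip_conflicts]
  by (simp add: clique_of_conflicts.pA_def[OF flip_conflicts] flip_sets pB_def)

lemma cross_no_ends: "ends T = {} \<Longrightarrow> cross P T Z = 0"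
proof -
  assume "ends T = {}"
  then have none: "{(s, x). s \<in> T \<and> x \<in> Z \<and> {s, x} \<in> P} = {}" by (auto simp: ends_def)
  show ?thesis unfolding cross_def none by simp
qed

definition outer_count where "outer_count = cross P A Z + cross P B Z + cross P C Z"

text \<open>
  The degree of an end is shared between edges of \<open>P\<close> and edges to other ends, and there are
  many of the latter. The number \<open>r\<close> is degree known to be spent otherwise.
\<close>

lemma outer_ends_bound:
  assumes "ends C \<noteq> {}" "ends (A \<union> B) \<noteq> {}"
    and slack: "(\<Sum>x\<in>ends S. card {s \<in> S. {s, x} \<in> P} + card {y \<in> ends S. adj x y}) + r \<le> d * card (ends S)"
  shows "2 * outer_count + (card (ends S))\<^sup>2 + 2 * r \<le> 2 * (d + 1) * card (ends S)"
proof -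
  have "(card (ends S))\<^sup>2 \<le> 2 * (\<Sum>x\<in>ends S. card {y \<in> ends S. adj x y}) + 2 * card (ends S)"
  proof (rule no_independent_triple_dense)
    show "adj x y \<Longrightarrow> adj y x" for x y using adj_sym by simp
    show "adj x y \<or> adj x z \<or> adj y z" if "x \<in> ends S" "y \<in> ends S" "z \<in> ends S" "x \<noteq> y" "x \<noteq> z" "y \<noteq> z" for x y z
      by (rule ends_no_independent_triple[OF assms(1,2) that])
  qed auto
  moreover have "outer_count + (\<Sum>x\<in>ends S. card {y \<in> ends S. adj x y}) + r \<le> d * card (ends S)"
    using slack outer_edges_at_ends by (simp add: outer_count_def sum.distrib)
  ultimately show ?thesis by (simp add: algebra_simps)
qed

definition degA where "degA z = card (A \<inter> nbrs z)"
definition degB where "degB z = card (B \<inter> nbrs z)"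

lemma ends_C_hit:
  assumes "z \<in> ends C"
  shows "\<And>x y. x \<in> A \<Longrightarrow> y \<in> A \<Longrightarrow> {x, y} \<in> P \<Longrightarrow> adj x z \<or> adj y z"
    "\<And>x y. x \<in> B \<Longrightarrow> y \<in> B \<Longrightarrow> {x, y} \<in> P \<Longrightarrow> adj x z \<or> adj y z"
  using inner_edge_hits_A[of _ _ z] inner_edge_hits_B[of _ _ z] assms by (auto simp: ends_Un)

text \<open>
  The degree of \<open>z\<close> accounts for its neighbours in \<open>A\<close> and \<open>B\<close>, all other ends, and a vertex of \<open>C\<close> that leads to \<open>z\<close>.
\<close>

lemma universal_end:
  assumes z: "z \<in> ends C" and univ: "\<And>y. y \<in> ends S \<Longrightarrow> y \<noteq> z \<Longrightarrow> adj z y"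
  shows "degA z + degB z + card (ends S) \<le> d"
    "pA + (card A - degA z choose 2) \<le> card A choose 2"
    "pB + (card B - degB z choose 2) \<le> card B choose 2"
proof -
  obtain w where w: "w \<in> C" "{w, z} \<in> P" "z \<in> Z" using z by (auto simp: ends_def)
  let ?X = "ends S - {z}"
  have zK: "z \<in> ends S" using z by (auto simp: ends_def)
  have fin: "finite ?X" by simp
  have XZ: "?X \<subseteq> Z" by (auto simp: ends_def)
  have "insert w ((A \<inter> nbrs z) \<union> (B \<inter> nbrs z) \<union> ?X) \<subseteq> nbrs z"
    using univ P_adj[OF w(2)] adj_sym[of w z] by (auto simp: nbrs_def)
  then have "card (insert w ((A \<inter> nbrs z) \<union> (B \<inter> nbrs z) \<union> ?X)) \<le> card (nbrs z)"
    by (intro card_mono finite_nbrs)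
  moreover have "w \<notin> A" "w \<notin> B" "w \<notin> ?X" using w(1) XZ disjoint_sets by auto
  moreover have "(A \<inter> nbrs z) \<inter> (B \<inter> nbrs z) = {}" "((A \<inter> nbrs z) \<union> (B \<inter> nbrs z)) \<inter> ?X = {}"
    using XZ disjoint_sets(1,4,5) by auto
  ultimately have "1 + (degA z + degB z + card ?X) \<le> card (nbrs z)"
    by (simp add: card_Un_disjoint degA_def degB_def)
  then show "degA z + degB z + card (ends S) \<le> d"
    using card_nbrs[of z] zK card_gt_0_iff[of "ends S"] by (auto simp: card_Diff_singleton)
  have "card (A - nbrs z) = card A - degA z" "card (B - nbrs z) = card B - degB z"
    by (simp_all add: card_Diff_subset_Int degA_def degB_def)
  then show "pA + (card A - degA z choose 2) \<le> card A choose 2"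
    "pB + (card B - degB z choose 2) \<le> card B choose 2"
    using inside_avoiding[of A z] inside_avoiding[of B z] ends_C_hit[OF z]
    by (simp_all add: pA_def pB_def)
qed

text \<open>
  As they are not adjacent, both ends are reached only from \<open>C\<close>. Hence edges of \<open>P\<close> inside \<open>A\<close> or \<open>B\<close>
  must hit both of their neighbourhoods, no vertex of \<open>S\<close> is a neighbour of both ends, and their neighbours
  in \<open>A\<close> and \<open>B\<close> use up degree that edges of \<open>P\<close> cannot use.
\<close>

lemma nonadjacent_ends:
  assumes z: "z \<in> ends C" and x: "x \<in> ends S" "x \<noteq> z" "\<not> adj z x"
  shows "pA \<le> degA z * degA x" "pB \<le> degB z * degB x"
    "degA z + degA x \<le> card A" "degB z + degB x \<le> card B" "2 \<le> card C"
    "(\<Sum>y\<in>ends S. card {s \<in> S. {s, y} \<in> P} + card {y' \<in> ends S. adj y y'})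
       + (degA z + degA x + degB z + degB x) \<le> d * card (ends S)"
proof -
  obtain w where w: "w \<in> C" "{w, z} \<in> P" "z \<in> Z" using z by (auto simp: ends_def)
  obtain w' where w': "w' \<in> S" "{w', x} \<in> P" "x \<in> Z" using x(1) by (auto simp: ends_def)
  have only: "s \<in> C" if "s \<in> S" "{s, x} \<in> P" for s
  proof (rule ccontr)
    assume "s \<notin> C"
    then have "\<not> same_side w s" using side_cases[of w s] w that by auto
    then show False using ends_of_different_sides[of w s z x] w w' that x by auto
  qed
  have only': "s \<in> C" if "s \<in> S" "{s, z} \<in> P" for s
  proof (rule ccontr)
    assume "s \<notin> C"
    then have "\<not> same_side s w'" using side_cases[of s w'] w' only[OF w'(1,2)] that by auto
    then show False using ends_of_different_sides[of s w' z x] w w' that x by auto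
  qed
  have xC: "x \<in> ends C" using only[OF w'(1,2)] w' by (auto simp: ends_def)
  have zS: "z \<in> ends S" using z by (auto simp: ends_def)
  have disj: "T \<inter> nbrs z \<inter> nbrs x = {}" if "T \<subseteq> S" for T
    using outer_clique[of _ z x] that w(3) w'(3) x adj_sym by (auto simp: nbrs_def)
  show "pA \<le> degA z * degA x" unfolding pA_def degA_def
    using ends_C_hit[OF z] ends_C_hit[OF xC] disj[of A] by (intro inside_two_hits) auto
  show "pB \<le> degB z * degB x" unfolding pB_def degB_def
    using ends_C_hit[OF z] ends_C_hit[OF xC] disj[of B] by (intro inside_two_hits) auto
  have half: "card (T \<inter> nbrs z) + card (T \<inter> nbrs x) \<le> card T" if T: "T \<subseteq> S" for T
  proof -
    have fT: "finite T" using T by (rule finite_subset) simp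
    have "card (T \<inter> nbrs z) + card (T \<inter> nbrs x) = card (T \<inter> nbrs z \<union> T \<inter> nbrs x)"
      using disj[OF T] fT by (intro card_Un_disjoint[symmetric]) auto
    also have "\<dots> \<le> card T" using fT by (intro card_mono) auto
    finally show ?thesis .
  qed
  show "degA z + degA x \<le> card A" "degB z + degB x \<le> card B"
    unfolding degA_def degB_def by (rule half, blast)+
  have "w \<noteq> w'"
    using outer_clique[of w z x] w w' x P_adj[OF w(2)] P_adj[OF w'(2)] by auto
  then have "card {w, w'} = 2" by simp
  moreover have "card {w, w'} \<le> card C" using w(1) only[OF w'(1,2)] by (intro card_mono) auto
  ultimately show "2 \<le> card C" by simp
  let ?f = "\<lambda>y. card {s \<in> S. {s, y} \<in> P} + card {y' \<in> ends S. adj y y'}"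
  have extra: "?f y + (degA y + degB y) \<le> d" if y: "y \<in> ends S" "\<And>s. s \<in> S \<Longrightarrow> {s, y} \<in> P \<Longrightarrow> s \<in> C" for y
  proof -
    let ?Y = "(A \<union> B) \<inter> nbrs y"
    have "card ?Y = degA y + degB y" unfolding degA_def degB_def Int_Un_distrib2
      using disjoint_sets(1) by (intro card_Un_disjoint) auto
    moreover have "{s \<in> S. {s, y} \<in> P} \<inter> ?Y = {}" using y(2) disjoint_sets(2,3) by blast
    moreover have "?Y \<subseteq> S \<inter> nbrs y" by auto
    ultimately show ?thesis using end_degree[OF y(1), of ?Y] by (simp only:)
  qed
  let ?R = "ends S - {z, x}"
  have "(\<Sum>y\<in>ends S. ?f y) = ?f z + (?f x + (\<Sum>y\<in>?R. ?f y))"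
  proof -
    have "ends S = insert z (insert x ?R)" using zS x(1) by auto
    then have "(\<Sum>y\<in>ends S. ?f y) = (\<Sum>y\<in>insert z (insert x ?R). ?f y)" by simp
    then show ?thesis using x(2) by simp
  qed
  moreover have "(\<Sum>y\<in>?R. ?f y) \<le> (\<Sum>y\<in>?R. d)"
    using end_degree[of _ "{}"] by (intro sum_mono) auto
  moreover have "card (ends S) = card ?R + 2"
  proof -
    have "card ?R = card (ends S) - card {z, x}" using zS x(1) by (intro card_Diff_subset) auto
    moreover have "card {z, x} \<le> card (ends S)" using zS x(1) by (intro card_mono) auto
    ultimately show ?thesis using x(2) by simp
  qed
  ultimately show "(\<Sum>y\<in>ends S. ?f y) + (degA z + degA x + degB z + degB x) \<le> d * card (ends S)"
    using extra[OF zS only'] extra[OF x(1) only] by (simp add: algebra_simps)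
qed

section \<open>The number of edges charged to one matching edge\<close>

text \<open>
  Adding the degree sums with suitable multiplicities to the two instances of \<open>card_conflicting\<close> removes the
  numbers of edges in \<open>G\<close> from \<open>S\<close> to \<open>Z\<close> and leaves no positive multiple of the numbers of edges between
  \<open>A\<close>, \<open>B\<close> and \<open>C\<close>. A degree sum enters twice where \<open>P\<close> may contain
  all edges to \<open>Z\<close>, and once where these edges are lost or counted separately.
\<close>

lemma conflict_count:
  "real (card {f \<in> edges G. conflict G {u, v} f}) + real (card P) \<le> 2 * (real d)\<^sup>2 + 2 * real d - 2"
proof -
  let ?E = "edges G"
  let ?F = "{f \<in> ?E. conflict G {u, v} f}"
  define a b c t eAC eBC e OA OB OC QA QB QC p q D where
    "a = real (card A)" "b = real (card B)" "c = real (card C)"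
    "t = real (cross ?E A B)" "eAC = real (cross ?E A C)" "eBC = real (cross ?E B C)"
    "e = real eC" "OA = real (cross ?E A Z)" "OB = real (cross ?E B Z)" "OC = real (cross ?E C Z)"
    "QA = real (cross P A Z)" "QB = real (cross P B Z)" "QC = real (cross P C Z)"
    "p = real pA" "q = real pB" "D = real d"
  note defs = this
  let ?T = "real (card ?F) + real (card P)"
  have nn: "0 \<le> a" "0 \<le> b" "0 \<le> c" "0 \<le> t" "0 \<le> eAC" "0 \<le> eBC" "0 \<le> e"
    "0 \<le> p" "0 \<le> q" "0 \<le> QA" "0 \<le> QB" "0 \<le> QC" by (auto simp: defs)
  have side: "a + c + 1 \<le> D" "b + c + 1 \<le> D" using card_sides by (auto simp: defs)
  have pl: "2*p \<le> a*(a-1)" "2*q \<le> b*(b-1)"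
    using of_nat_mono[OF pA_le, where ?'a = real] of_nat_mono[OF pB_le, where ?'a = real]
    by (auto simp: defs real_choose_two)
  have Q: "QA \<le> OA" "QB \<le> OB" "QC \<le> OC"
    using cross_mono[OF _ _ P_edges] by (auto simp: defs)
  have dA: "a + a*(a-1) + t + eAC + OA \<le> D*a"
    using of_nat_mono[OF degree_sum_A, where ?'a = real] by (simp add: defs real_choose_two)
  have dB: "b + b*(b-1) + t + eBC + OB \<le> D*b"
    using of_nat_mono[OF degree_sum_B, where ?'a = real] by (simp add: defs real_choose_two)
  have dC: "2*c + 2*e + eAC + eBC + OC \<le> D*c"
    using of_nat_mono[OF degree_sum_C, where ?'a = real] by (simp add: defs)
  have F: "real (card ?F) \<le> 1 + a + b + 2*c + a*(a-1)/2 + b*(b-1)/2 + e + t + eAC + eBC + (OA + OB + OC)"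
  proof -
    have "card {f \<in> ?F. f \<subseteq> A} \<le> card A choose 2" "card {f \<in> ?F. f \<subseteq> B} \<le> card B choose 2"
      unfolding card_edges_A[symmetric] card_edges_B[symmetric]
      using finite_edges by (auto intro!: card_mono)
    moreover have "cross ?F A Z \<le> cross ?E A Z" "cross ?F B Z \<le> cross ?E B Z" "cross ?F C Z \<le> cross ?E C Z"
      by (auto intro!: cross_mono)
    ultimately have "card ?F \<le> 1 + card A + card B + 2 * card C + (card A choose 2) + (card B choose 2) + eC
      + cross ?E A B + cross ?E A C + cross ?E B C + (cross ?E A Z + cross ?E B Z + cross ?E C Z)"
      using card_conflicting[OF order_refl] by linarith
    from of_nat_mono[OF this, where ?'a = real] show ?thesis by (simp add: defs real_choose_two)
  qed
  have P: "real (card P) \<le> 1 + a + b + 2*c + p + q + e + t + eAC + eBC + (QA + QB + QC)"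
    using of_nat_mono[OF card_conflicting[OF P_sub], where ?'a = real] by (simp add: defs pA_def pB_def)
  have dabc: "D*(a+b+c) = D*a + D*b + D*c" by (simp add: algebra_simps)
  have small: ?thesis if "card A \<le> 2 \<or> card B \<le> 2"
  proof -
    have "?T \<le> 2 + 2*D*(a+b+c) - a*(a-1) - b*(b-1)"
      using F P pl Q dA dB dC nn dabc by argo
    also have "\<dots> \<le> 2*D^2 + 2*D - 2"
    proof -
      have "a = 0 \<or> a = 1 \<or> a = 2 \<or> b = 0 \<or> b = 1 \<or> b = 2"
        using that unfolding defs by (auto simp: le_Suc_eq numeral_2_eq_2)
      then consider "b = 0 \<or> b = 1 \<or> b = 2" | "a = 0 \<or> a = 1 \<or> a = 2" by blast
      then show ?thesis
      proof cases
        case 1 then show ?thesis using numeric_small[OF side] nn by simp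
      next
        case 2 then show ?thesis using numeric_small[OF side(2,1)] nn by (simp add: algebra_simps)
      qed
    qed
    finally show ?thesis by (simp add: defs)
  qed
  have noC: ?thesis if big: "3 \<le> a" "3 \<le> b" and none: "ends C = {}"
  proof -
    have QC: "QC = 0" using cross_no_ends[OF none] by (simp add: defs)
    have pq: "p*q \<le> t*((a-1)*(b-1))"
    proof -
      have "real (card A - 1) = a - 1" "real (card B - 1) = b - 1" using big by (auto simp: defs)
      then show ?thesis
        using of_nat_mono[OF inner_product_bound, where ?'a = real] by (simp add: defs)
    qed
    have T: "?T \<le> 2 + 2*c + 2*(D*a) + 2*(D*b) + D*c - 3/2*(a*(a-1)) - 3/2*(b*(b-1)) - 2*t + p + q"
      using F P QC Q(1,2) dA dB dC nn by argo
    have "?T \<le> 2*D^2 + 2*D - 2"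
    proof (cases "b \<le> a")
      case True
      have "2*(p + q - 2*t) \<le> a*(a-1)" using True big pl nn pq by (intro numeric_inner_tradeoff[of b]) auto
      moreover have "2 + 2*D*(a+b) + D*c + 2*c - a*(a-1) - 3/2*(b*(b-1)) \<le> 2*D^2 + 2*D - 2"
        using side nn big by (intro numeric_no_common) auto
      moreover have "2*D*(a+b) = 2*(D*a) + 2*(D*b)" by (simp add: algebra_simps)
      ultimately show ?thesis using T by argo
    next
      case False
      have "2*(q + p - 2*t) \<le> b*(b-1)" using False big pl nn pq
        by (intro numeric_inner_tradeoff[of a]) (auto simp: mult.commute)
      moreover have "2 + 2*D*(b+a) + D*c + 2*c - b*(b-1) - 3/2*(a*(a-1)) \<le> 2*D^2 + 2*D - 2"
        using side nn big by (intro numeric_no_common) auto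
      moreover have "2*D*(b+a) = 2*(D*a) + 2*(D*b)" by (simp add: algebra_simps)
      ultimately show ?thesis using T by argo
    qed
    then show ?thesis by (simp add: defs)
  qed
  have noAB: ?thesis if none: "ends (A \<union> B) = {}"
  proof -
    have "QA = 0" "QB = 0" using none cross_no_ends[of A] cross_no_ends[of B] by (auto simp: defs ends_Un)
    note Q0 = this
    have "?T \<le> 2 + a + b + D*a + D*b + 2*(D*c)"
      using F P Q0 Q(3) pl dA dB dC nn by argo
    also have "\<dots> = 2 + (D+1)*(a+b) + 2*(D*c)" by (simp add: algebra_simps)
    also have "\<dots> \<le> 2 + (D+1)*(2*(D-1-c)) + 2*(D*c)"
      using side nn by (intro add_mono mult_left_mono order_refl) auto
    also have "\<dots> \<le> 2*D^2 + 2*D - 2"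
      using side nn by (simp add: algebra_simps power2_eq_square)
    finally show ?thesis by (simp add: defs)
  qed
  have both: ?thesis if big: "3 \<le> a" "3 \<le> b" and ne: "ends C \<noteq> {}" "ends (A \<union> B) \<noteq> {}"
  proof -
    define m where "m = real (card (ends S))"
    define Q where "Q = real outer_count"
    have QQ: "Q = QA + QB + QC" by (simp add: Q_def outer_count_def defs)
    have T: "?T \<le> 2 + (D+1)*(a+b) + (D+2)*c + Q - a*(a-1)/2 - b*(b-1)/2 + p + q"
    proof -
      have "(D+1)*(a+b) + (D+2)*c = D*a + D*b + D*c + a + b + 2*c" by (simp add: algebra_simps)
      then show ?thesis using F P dA dB dC nn unfolding QQ by argo
    qed
    have c1: "1 \<le> c"
    proof -
      have "C \<noteq> {}" using ne(1) by (auto simp: ends_def)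
      then have "1 \<le> card C" using card_gt_0_iff[of C] by auto
      then show ?thesis by (simp add: defs)
    qed
    have outer_count: "Q \<le> m*(D+1) - m^2/2 - r"
      if "(\<Sum>x\<in>ends S. card {s \<in> S. {s, x} \<in> P} + card {y \<in> ends S. adj x y}) + n \<le> d * card (ends S)"
        "r = real n" for r n
      using of_nat_mono[OF outer_ends_bound[OF ne that(1)], where ?'a = real] that(2)
      by (simp add: m_def Q_def defs algebra_simps)
    have "?T \<le> 2*D^2 + 2*D - 2"
    proof (cases "\<exists>z\<in>ends C. \<forall>y\<in>ends S. y \<noteq> z \<longrightarrow> adj z y")
      case True
      then obtain z where z: "z \<in> ends C" and univ: "\<And>y. y \<in> ends S \<Longrightarrow> y \<noteq> z \<Longrightarrow> adj z y" by blast
      define x y where "x = real (degA z)" "y = real (degB z)"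
      have "degA z \<le> card A" "degB z \<le> card B" by (auto simp: degA_def degB_def intro!: card_mono)
      then have sub: "real (card A - degA z) = a - x" "real (card B - degB z) = b - y"
        by (auto simp: defs x_y_def)
      have ps: "p \<le> a*(a-1)/2 - (a-x)*(a-x-1)/2" "q \<le> b*(b-1)/2 - (b-y)*(b-y-1)/2"
        using of_nat_mono[OF universal_end(2)[OF z univ], where ?'a = real]
          of_nat_mono[OF universal_end(3)[OF z univ], where ?'a = real]
        by (simp_all add: real_choose_two sub) (simp_all add: defs)
      have m: "x + y + m \<le> D"
        using of_nat_mono[OF universal_end(1)[OF z univ], where ?'a = real] by (simp add: x_y_def m_def defs)
      have "z \<in> ends S" using z by (auto simp: ends_def)
      then have "1 \<le> card (ends S)" using card_gt_0_iff[of "ends S"] by auto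
      then have m1: "1 \<le> m" by (simp add: m_def)
      have "(\<Sum>x\<in>ends S. card {s \<in> S. {s, x} \<in> P} + card {y \<in> ends S. adj x y}) \<le> (\<Sum>x\<in>ends S. d)"
        using end_degree[of _ "{}"] by (intro sum_mono) auto
      then have Qm: "Q \<le> m*(D+1) - m^2/2" using outer_count[of 0 0] by (simp add: mult.commute)
      have "2 + (D+1)*(a+b) + (D+2)*c + (m*(D+1) - m^2/2)
         - (a-x)*(a-x-1)/2 - (b-y)*(b-y-1)/2 \<le> 2*D^2+2*D-2"
        using side big c1 m m1 by (intro numeric_universal) (auto simp: x_y_def)
      then show ?thesis using T ps Qm by argo
    next
      case False
      obtain z where z: "z \<in> ends C" using ne(1) by blast
      with False obtain x where x: "x \<in> ends S" "x \<noteq> z" "\<not> adj z x" by blast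
      note na = nonadjacent_ends[OF z x]
      define y1 y2 w1 w2 where y_def: "y1 = real (degA z)" "y2 = real (degA x)" "w1 = real (degB z)" "w2 = real (degB x)"
      have ps: "p \<le> y1*y2" "q \<le> w1*w2"
        using of_nat_mono[OF na(1), where ?'a = real] of_nat_mono[OF na(2), where ?'a = real]
        by (simp_all add: y_def defs)
      have hs: "y1 + y2 \<le> a" "w1 + w2 \<le> b" "2 \<le> c" using na(3-5) by (auto simp: y_def defs)
      have Qm: "Q \<le> m*(D+1) - m^2/2 - (y1+y2+w1+w2)"
        by (rule outer_count[OF na(6)]) (simp add: y_def)
      have "2 + (D+1)*(a+b) + (D+2)*c + (m*(D+1) - m^2/2 - (y1+y2+w1+w2))
         - a*(a-1)/2 - b*(b-1)/2 + y1*y2 + w1*w2 \<le> 2*D^2+2*D-2"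
        using side big hs by (intro numeric_nonadjacent) (auto simp: y_def)
      then show ?thesis using T ps Qm by argo
    qed
    then show ?thesis by (simp add: defs)
  qed
  have "card A \<le> 2 \<or> card B \<le> 2 \<or> (3 \<le> a \<and> 3 \<le> b)" by (auto simp: defs)
  then show ?thesis using small noC noAB both by blast
qed

end

theorem lemma9:
  fixes G :: "'a graph" and d :: nat and M :: "'a set set"
  assumes "d \<ge> 3"
    and "simple_graph G"
    and "claw_free G"
    and "max_degree G = d"
    and "local_search_output G M"
  shows "real (card M) \<ge> real (size_graph G) / (real d ^ 2 + real d - 1)"
proof -
  interpret claw_free_graph G d using assms by unfold_locales auto
  have d1: "1 \<le> d" using assms(1) by simp
  have K: "real (d\<^sup>2 + d - 1) = real d ^ 2 + real d - 1" using d1 by (simp add: of_nat_diff)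
  have "card (edges G) \<le> (d\<^sup>2 + d - 1) * card M"
  proof (rule locally_optimal_bound[OF assms(2) local_search_output_locally_optimal[OF assms(2,5)]])
    fix e P
    assume e: "e \<in> edges G" and P: "P \<subseteq> {f \<in> edges G. conflict G e f}" "\<forall>f\<in>P. \<forall>g\<in>P. conflict G f g"
    obtain u v where e_uv: "e = {u, v}" "adj u v" using e by (rule edgeE)
    interpret clique_of_conflicts G d u v P
      using e_uv P by unfold_locales auto
    have "real (card {f \<in> edges G. conflict G e f} + card P) \<le> real (2 * (d\<^sup>2 + d - 1))"
      using conflict_count K by (simp add: e_uv(1))
    then show "card {f \<in> edges G. conflict G e f} + card P \<le> 2 * (d\<^sup>2 + d - 1)" by linarith
  qed
  then have "real (card (edges G)) \<le> (real d ^ 2 + real d - 1) * real (card M)"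
    using K by (metis of_nat_le_iff of_nat_mult)
  moreover have "0 < real d ^ 2" "1 \<le> real d" using d1 by simp_all
  then have "0 < real d ^ 2 + real d - 1" by linarith
  ultimately show ?thesis by (simp add: size_graph_def divide_le_eq mult.commute)
qed

end
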